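(* Let $I=(a_-,a_+)\subset\mathbb{R}$ be a bounded open interval, $p\in[1,\infty)$, and let $w\in L^1(I)$ be a weight that is $\mu_w$-a.e. non-critical. Let $x_0\in\bar I=[a_-,a_+]$ and let $k\ge 0$ be an integer. If $x_0\notin \bar I_{cr}^{\,k,p}(w)$, then there exists a neighbourhood $\mathcal{V}\ni x_0$, relatively open in $\bar I$, such that $$H^{k,p}_{\mu_w}\hookrightarrow L^1(\mathcal{V}).$$ In particular, if $\bar I_{cr}^{\,k,p}(w)=\varnothing$, then $\mathcal{V}$ may be chosen as $\bar I$, i.e. $H^{k,p}_{\mu_w}\hookrightarrow L^1(\bar I)$.
   Context: A weight is a non-negative function $w\in L^1(I)$, $I=(a_-,a_+)$ bounded. $\mathcal{L}^1$ is Lebesgue measure, $\mu_w:=w\,\mathcal{L}^1$ restricted to $I$, and $L^p_{\mu_w}$ is the Lebesgue space with norm $(\int_I w|u|^p\,dx)^{1/p}$. $p'=p/(p-1)$ is the Hölder conjugate ($p'=\infty$ if $p=1$). Convention: $\alpha/0=0$ if $\alpha=0$ and $\alpha/0=\infty$ if $\alpha>0$. $\mathcal{D}(\mathbb{R})$ denotes smooth compactly supported functions on $\mathbb{R}$ (they need not vanish at $a_\pm$). Critical set of order $\alpha\in[0,\infty)$: for $p\in(1,\infty)$, $$\bar I_{cr}^{\,\alpha,p}(w):=\Big\{x_0\in\bar I:\ \forall\varepsilon>0\ \int_{\bar I\cap B(x_0,\varepsilon)}\Big(\frac{|x-x_0|^\alpha}{(w(x))^{1/p}}\Big)^{p'}dx=\infty\Big\},$$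 and for $p=1$, $\bar I_{cr}^{\,\alpha,1}(w):=\{x_0\in\bar I:\ \forall\varepsilon>0\ \ \mathcal{L}^1\text{-}\mathrm{ess\,sup}\{|x-x_0|^\alpha/w(x): x\in\bar I\cap B(x_0,\varepsilon)\}=\infty\}$. The weight $w$ is $\mu_w$-a.e. non-critical if $\mu_w(\bar I_{cr}^{\,0,p}(w))=0$. For such $w$, put $H^{0,p}_{\mu_w}:=L^p_{\mu_w}$, and for an integer $m\ge1$ let $H^{m,p}_{\mu_w}$ be the set of $u\in L^p_{\mu_w}$ for which there exist $u_h\in\mathcal{D}(\mathbb{R})$ and $v_1,\dots,v_m\in L^p_{\mu_w}$ with $u_h\to u$ and $D^ku_h\to v_k$ in $L^p_{\mu_w}$, $k=1,\dots,m$ (classical derivatives). The $v_k$ are uniquely determined by $u$ and are denoted $D^k_{\mu_w}u$ (tangential derivatives), with $D^0_{\mu_w}u:=u$. The norm is $\|u\|_{H^{m,p}_{\mu_w}}=(\sum_{k=0}^m\|D^k_{\mu_w}u\|^p_{L^p_{\mu_w}})^{1/p}$. $L^1(\mathcal{V})$ is taken with respect to Lebesgue measure, and $\hookrightarrow$ means continuous embedding (by restriction): there is $C<\infty$ with $\int_{\mathcal V}|u|\,dx\le C\|u\|_{H^{k,p}_{\mu_w}}$ for all $u\in H^{k,p}_{\mu_w}$. *)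

theory Defs
  imports "HOL-Probability.Essential_Supremum"
begin

text \<open>
  Throughout, \<open>I = {a<..<b}\<close>. Weights and elements of function spaces are represented by total
  functions \<open>real \<Rightarrow> real\<close>; their values outside \<open>I\<close> are irrelevant, since every measure below
  either lives on \<open>I\<close> or is Lebesgue measure on a subset of \<open>{a..b}\<close>.
  Classes modulo a.e. equality are not quotiented out: the function spaces are sets of
  representatives, closed under a.e. equality with respect to the weighted measure.
\<close>

definition weight :: "real \<Rightarrow> real \<Rightarrow> (real \<Rightarrow> real) \<Rightarrow> bool" where
  "weight a b w \<longleftrightarrow> (\<forall>x\<in>{a<..<b}. 0 \<le> w x) \<and> set_integrable lebesgue {a<..<b} w"

definition weighted_measure :: "real \<Rightarrow> real \<Rightarrow> (real \<Rightarrow> real) \<Rightarrow> real measure" where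
  "weighted_measure a b w = density (lebesgue_on {a<..<b}) (\<lambda>x. ennreal (w x))"

definition holder_conj :: "real \<Rightarrow> real" where
  "holder_conj p = p / (p - 1)"

text \<open>Real power of an extended nonnegative number, for positive exponents.\<close>

definition ennreal_powr :: "ennreal \<Rightarrow> real \<Rightarrow> ennreal" where
  "ennreal_powr x r = (if x = \<infinity> then \<infinity> else ennreal (enn2real x powr r))"

text \<open>
  The quotient \<open>\<bar>x - x0\<bar>\<^sup>\<alpha> / w(x)\<^sup>1\<^sup>/\<^sup>p\<close>. Division on \<^typ>\<open>ennreal\<close> satisfies \<open>0/0 = 0\<close> and
  \<open>c/0 = \<infinity>\<close> for \<open>c > 0\<close>. The case \<open>\<alpha> = 0\<close> is separate because \<open>0 powr 0 = 0\<close> in HOL.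
\<close>

definition crit_quotient :: "real \<Rightarrow> real \<Rightarrow> (real \<Rightarrow> real) \<Rightarrow> real \<Rightarrow> real \<Rightarrow> ennreal" where
  "crit_quotient p \<alpha> w x0 x =
     ennreal (if \<alpha> = 0 then 1 else \<bar>x - x0\<bar> powr \<alpha>) / ennreal (w x powr (1 / p))"

definition critical_set :: "real \<Rightarrow> real \<Rightarrow> real \<Rightarrow> real \<Rightarrow> (real \<Rightarrow> real) \<Rightarrow> real set" where
  "critical_set a b p \<alpha> w =
     {x0 \<in> {a..b}. \<forall>\<epsilon>>0.
        if p = 1
        then esssup (lebesgue_on ({a..b} \<inter> ball x0 \<epsilon>)) (crit_quotient p \<alpha> w x0) = \<infinity>
        else (\<integral>\<^sup>+x\<in>{a..b} \<inter> ball x0 \<epsilon>.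
                ennreal_powr (crit_quotient p \<alpha> w x0 x) (holder_conj p) \<partial>lebesgue) = \<infinity>}"

text \<open>
  The intersection with \<open>I\<close> is needed because sets not contained in the space \<open>I\<close> of the
  weighted measure are not measurable for it; the endpoints carry no mass.
\<close>

definition ae_noncritical :: "real \<Rightarrow> real \<Rightarrow> real \<Rightarrow> (real \<Rightarrow> real) \<Rightarrow> bool" where
  "ae_noncritical a b p w \<longleftrightarrow>
     critical_set a b p 0 w \<inter> {a<..<b} \<in> null_sets (weighted_measure a b w)"

definition Lp :: "real \<Rightarrow> 'a measure \<Rightarrow> ('a \<Rightarrow> real) set" where
  "Lp p M = {u \<in> borel_measurable M. integrable M (\<lambda>x. \<bar>u x\<bar> powr p)}"

definition Lp_norm :: "real \<Rightarrow> 'a measure \<Rightarrow> ('a \<Rightarrow> real) \<Rightarrow> real" where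
  "Lp_norm p M u = (\<integral>x. \<bar>u x\<bar> powr p \<partial>M) powr (1 / p)"

text \<open>
  Convergence is meant for sequences in \<^const>\<open>Lp\<close> with limit in \<^const>\<open>Lp\<close>. Test functions and
  their derivatives are bounded, hence in \<^const>\<open>Lp\<close> of every weighted measure used here.
\<close>

definition tendsto_Lp :: "real \<Rightarrow> 'a measure \<Rightarrow> (nat \<Rightarrow> 'a \<Rightarrow> real) \<Rightarrow> ('a \<Rightarrow> real) \<Rightarrow> bool" where
  "tendsto_Lp p M U u \<longleftrightarrow> (\<lambda>h. Lp_norm p M (\<lambda>x. U h x - u x)) \<longlonglongrightarrow> 0"

definition test_functions :: "(real \<Rightarrow> real) set" where
  "test_functions =
     {\<phi>. (\<forall>n x. (deriv ^^ n) \<phi> field_differentiable at x) \<and> compact (closure {x. \<phi> x \<noteq> 0})}"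

definition has_tangential_derivs ::
  "real \<Rightarrow> real \<Rightarrow> real \<Rightarrow> (real \<Rightarrow> real) \<Rightarrow> nat \<Rightarrow> (real \<Rightarrow> real) \<Rightarrow> (nat \<Rightarrow> real \<Rightarrow> real) \<Rightarrow> bool" where
  "has_tangential_derivs a b p w m u v \<longleftrightarrow>
     (let M = weighted_measure a b w in
        u \<in> Lp p M \<and> (\<forall>j\<in>{1..m}. v j \<in> Lp p M) \<and>
        (\<exists>U. (\<forall>h. U h \<in> test_functions) \<and> tendsto_Lp p M U u \<and>
             (\<forall>j\<in>{1..m}. tendsto_Lp p M (\<lambda>h. (deriv ^^ j) (U h)) (v j))))"

definition sobolev :: "real \<Rightarrow> real \<Rightarrow> real \<Rightarrow> (real \<Rightarrow> real) \<Rightarrow> nat \<Rightarrow> (real \<Rightarrow> real) set" where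
  "sobolev a b p w m =
     (if m = 0 then Lp p (weighted_measure a b w)
      else {u \<in> Lp p (weighted_measure a b w). \<exists>v. has_tangential_derivs a b p w m u v})"

text \<open>
  For an a.e. non-critical weight the tangential derivatives are unique up to a.e. equality, so
  the choice below does not affect norms, and derivatives chosen at order \<open>j\<close> agree a.e. with
  the \<open>j\<close>-th entry of any witness of higher order.
\<close>

definition tangential_deriv ::
  "real \<Rightarrow> real \<Rightarrow> real \<Rightarrow> (real \<Rightarrow> real) \<Rightarrow> nat \<Rightarrow> (real \<Rightarrow> real) \<Rightarrow> real \<Rightarrow> real" where
  "tangential_deriv a b p w j u =
     (if j = 0 then u
      else (SOME d. \<exists>v. has_tangential_derivs a b p w j u v \<and> v j = d))"

definition sobolev_norm ::
  "real \<Rightarrow> real \<Rightarrow> real \<Rightarrow> (real \<Rightarrow> real) \<Rightarrow> nat \<Rightarrow> (real \<Rightarrow> real) \<Rightarrow> real" where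
  "sobolev_norm a b p w m u =
     (\<Sum>j=0..m. Lp_norm p (weighted_measure a b w) (tangential_deriv a b p w j u) powr p)
       powr (1 / p)"

text \<open>
  Since the bound is required of every representative, it also gives independence of the
  representative: on \<open>V\<close>, functions that agree a.e. for the weighted measure agree
  Lebesgue-a.e.
\<close>

definition sobolev_embeds_L1 ::
  "real \<Rightarrow> real \<Rightarrow> real \<Rightarrow> (real \<Rightarrow> real) \<Rightarrow> nat \<Rightarrow> real set \<Rightarrow> bool" where
  "sobolev_embeds_L1 a b p w m V \<longleftrightarrow>
     (\<exists>C. \<forall>u\<in>sobolev a b p w m.
        set_integrable lebesgue V u \<and>
        (LINT x:V|lebesgue. \<bar>u x\<bar>) \<le> C * sobolev_norm a b p w m u)"

end

theory Submission
  imports Defs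
begin

text \<open>
  Write \<open>I\<close> for the open interval, \<open>M\<close> for the weighted measure and \<open>\<parallel>f\<parallel>\<close> for the norm of
  \<open>L\<^sup>p(M)\<close>. Noncriticality of order \<open>k\<close> at \<open>x\<^sub>0\<close> says that \<open>\<bar>x - x\<^sub>0\<bar>\<^sup>k / w\<^sup>1\<^sup>/\<^sup>p\<close> lies in the dual
  Lebesgue space near \<open>x\<^sub>0\<close>, so Hoelder's inequality gives, on some ball \<open>B\<close> around \<open>x\<^sub>0\<close>,

  \<open>\<integral>\<^bsub>I \<inter> B\<^esub> \<bar>x - x\<^sub>0\<bar>\<^sup>k \<bar>f\<bar> dx \<le> C \<parallel>f\<parallel>\<close>  for all \<open>f\<close> in \<open>L\<^sup>p(M)\<close>

  (\<open>noncritical_imp_weighted_bound\<close>).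
  For \<open>k = 0\<close> it already is the local embedding.

  For \<open>k \<ge> 1\<close> the power \<open>\<bar>x - x\<^sub>0\<bar>\<^sup>k\<close> has to be removed, at the price of \<open>k\<close> derivatives. Hardy's
  inequality (\<open>hardy_step\<close>) trades one power of the distance for one derivative,

  \<open>\<integral>\<^sub>0\<^sup>r t\<^sup>m \<bar>g\<bar> dt \<le> c \<integral>\<^bsub>r/2\<^esub>\<^sup>r \<bar>g\<bar> dt + c \<integral>\<^sub>0\<^sup>r t\<^sup>m\<^sup>+\<^sup>1 \<bar>g'\<bar> dt\<close>,

  and the first term on the right lives where the distance is bounded below, so it is dominated
  by \<open>\<integral> t\<^sup>k \<bar>g\<bar>\<close>. Iterating from \<open>m = 0\<close> to \<open>m = k\<close> on both sides of \<open>x\<^sub>0\<close> (\<open>hardy_ball\<close>) bounds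
  \<open>\<integral> \<bar>U\<bar>\<close> for a test function \<open>U\<close> by the sum over \<open>j \<le> k\<close> of \<open>\<integral> \<bar>x - x\<^sub>0\<bar>\<^sup>k \<bar>D\<^sup>j U\<bar>\<close>, hence by the
  norms \<open>\<parallel>D\<^sup>j U\<parallel>\<close>. The bound passes to an element of the Sobolev space by Fatou's lemma, because the
  weighted bound also makes a subsequence of the approximating test functions converge almost
  everywhere (\<open>noncritical_imp_tangential_bound\<close>).

  What remains is to identify the limits of the derivatives along one approximating sequence
  with the tangential derivatives that occur in the Sobolev norm, which are chosen separately
  for each order. Near a point that is noncritical of order \<open>0\<close> the weighted bound says that
  convergence in \<open>L\<^sup>p(M)\<close> implies convergence in \<open>L\<^sup>1\<close>. There the limit of the derivatives is
  determined by the limit of the functions (\<open>derivative_limit_zero\<close>), and countably many such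
  neighbourhoods cover \<open>I\<close> up to a null set of \<open>M\<close>, because the critical set of order \<open>0\<close> is such
  a null set (\<open>tangential_derivs_unique\<close>). If there is no critical point of order \<open>k\<close>, finitely many of
  the neighbourhoods cover the closed interval, and the local bounds add up.
\<close>

section \<open>A weighted \<open>L\<^sup>1\<close> bound near noncritical points\<close>

text \<open>
  Hoelder's inequality with the unsharp constant \<open>\<integral> r\<^sup>q + 1\<close> in place of \<open>(\<integral> r\<^sup>q)\<^sup>1\<^sup>/\<^sup>q\<close>. Only
  the finiteness of the constant matters below, and this form follows at once from Young's
  inequality for \<open>r\<close> and \<open>s / N\<close>.
\<close>

lemma nn_integral_mult_le_of_powr:
  fixes r s :: "'a \<Rightarrow> real" and p N :: real
  assumes p: "1 < p"
    and [measurable]: "r \<in> borel_measurable M" "s \<in> borel_measurable M"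
    and nn: "\<And>x. 0 \<le> r x" "\<And>x. 0 \<le> s x" "0 \<le> N"
    and N: "(\<integral>\<^sup>+x. ennreal (s x powr p) \<partial>M) \<le> ennreal (N powr p)"
  shows "(\<integral>\<^sup>+x. ennreal (r x * s x) \<partial>M)
           \<le> ((\<integral>\<^sup>+x. ennreal (r x powr holder_conj p) \<partial>M) + 1) * ennreal N"
proof -
  define q where "q = holder_conj p"
  have q: "1 < q" "1 / p + 1 / q = 1"
    using p by (auto simp: q_def holder_conj_def field_simps)
  show ?thesis
  proof (cases "N = 0")
    case True
    with N p have "(\<integral>\<^sup>+x. ennreal (s x powr p) \<partial>M) = 0" by simp
    then have "AE x in M. s x powr p \<le> 0"
      by (subst (asm) nn_integral_0_iff_AE) (auto simp: ennreal_eq_0_iff)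
    then have "AE x in M. ennreal (r x * s x) = 0"
      by eventually_elim (use p nn powr_ge_zero in \<open>metis (no_types) antisym ennreal_0 mult_zero_right powr_eq_0_iff\<close>)
    then have "(\<integral>\<^sup>+x. ennreal (r x * s x) \<partial>M) = 0"
      by (subst nn_integral_0_iff_AE) auto
    then show ?thesis by simp
  next
    case False
    with nn have Npos: "0 < N" by simp
    have le: "ennreal (r x * s x)
       \<le> ennreal N * (ennreal (r x powr q) + ennreal (1 / N powr p) * ennreal (s x powr p))" for x
    proof -
      have "r x * (s x / N) \<le> r x powr q / q + (s x / N) powr p / p"
        using Youngs_inequality[of q p "r x" "s x / N"] q p nn Npos by (auto simp: add.commute)
      also have "\<dots> \<le> r x powr q + (s x / N) powr p"
        using q p mult_right_mono[of 1 q "r x powr q"] mult_right_mono[of 1 p "(s x / N) powr p"]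
        by (intro add_mono) (simp_all add: pos_divide_le_eq mult.commute)
      finally have "r x * s x \<le> N * (r x powr q + (1 / N powr p) * s x powr p)"
        using Npos nn by (simp add: field_simps powr_divide)
      then show ?thesis using Npos nn
        by (metis (no_types, lifting) add_nonneg_nonneg divide_nonneg_nonneg ennreal_leI ennreal_mult'' ennreal_plus
            less_eq_real_def mult_nonneg_nonneg powr_ge_zero zero_le_one)
    qed
    have "(\<integral>\<^sup>+x. ennreal (r x * s x) \<partial>M)
       \<le> (\<integral>\<^sup>+x. ennreal N * (ennreal (r x powr q) + ennreal (1 / N powr p) * ennreal (s x powr p)) \<partial>M)"
      by (intro nn_integral_mono le)
    also have "\<dots> = ennreal N * ((\<integral>\<^sup>+x. ennreal (r x powr q) \<partial>M)
        + ennreal (1 / N powr p) * (\<integral>\<^sup>+x. ennreal (s x powr p) \<partial>M))"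
      by (simp add: nn_integral_cmult nn_integral_add)
    also have "\<dots> \<le> ennreal N * ((\<integral>\<^sup>+x. ennreal (r x powr q) \<partial>M) + ennreal (1 / N powr p) * ennreal (N powr p))"
      by (intro mult_left_mono add_left_mono N) auto
    also have "ennreal (1 / N powr p) * ennreal (N powr p) = 1"
      using Npos by (simp flip: ennreal_mult'')
    finally show ?thesis by (simp add: q_def mult.commute)
  qed
qed

lemma weight_measurable:
  assumes "weight a b w"
  shows "w \<in> borel_measurable (lebesgue_on {a<..<b})"
  using assms borel_measurable_integrable
  by (auto simp: weight_def set_integrable_def borel_measurable_restrict_space_iff)

lemma weighted_measure_sets [simp, measurable_cong]:
  "sets (weighted_measure a b w) = sets (lebesgue_on {a<..<b})"
  by (simp add: weighted_measure_def)

lemma borel_measurable_weighted_measure [simp]: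
  "borel_measurable (weighted_measure a b w) = borel_measurable (lebesgue_on {a<..<b})"
  by (rule measurable_cong_sets) simp_all

lemma Lp_measurable:
  "f \<in> Lp p (weighted_measure a b w) \<Longrightarrow> f \<in> borel_measurable (lebesgue_on {a<..<b})"
  by (simp add: Lp_def)

lemma Lp_norm_nonneg [simp]: "0 \<le> Lp_norm p M f"
  by (simp add: Lp_norm_def)

lemma nn_integral_Lp_norm:
  assumes "weight a b w" "1 \<le> p" "f \<in> Lp p (weighted_measure a b w)"
  shows "(\<integral>\<^sup>+x. ennreal (w x) * ennreal (\<bar>f x\<bar> powr p) \<partial>lebesgue_on {a<..<b})
           = ennreal (Lp_norm p (weighted_measure a b w) f powr p)"
proof -
  let ?M = "weighted_measure a b w" and ?L = "lebesgue_on {a<..<b}"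
  have [measurable]: "w \<in> borel_measurable ?L" "f \<in> borel_measurable ?L"
    using weight_measurable[OF assms(1)] Lp_measurable[OF assms(3)] by auto
  have "(\<integral>\<^sup>+x. ennreal (w x) * ennreal (\<bar>f x\<bar> powr p) \<partial>?L) = (\<integral>\<^sup>+x. ennreal (\<bar>f x\<bar> powr p) \<partial>?M)"
    unfolding weighted_measure_def by (subst nn_integral_density) auto
  also have "\<dots> = ennreal (\<integral>x. \<bar>f x\<bar> powr p \<partial>?M)"
    using assms(3) by (intro nn_integral_eq_integral) (auto simp: Lp_def)
  also have "(\<integral>x. \<bar>f x\<bar> powr p \<partial>?M) = Lp_norm p ?M f powr p"
    using assms(2) by (simp add: Lp_norm_def powr_powr integral_nonneg_AE)
  finally show ?thesis .
qed

lemma nn_integral_lebesgue_on_subset: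
  assumes "A \<subseteq> B" "A \<in> sets lebesgue" "B \<in> sets lebesgue"
  shows "(\<integral>\<^sup>+x. f x \<partial>lebesgue_on A) \<le> (\<integral>\<^sup>+x. f x \<partial>lebesgue_on B)"
  using assms by (auto simp: nn_integral_restrict_space intro!: nn_integral_mono split: split_indicator)

lemma borel_measurable_lebesgue_on_subset:
  assumes "f \<in> borel_measurable (lebesgue_on B)" "A \<subseteq> B"
  shows "f \<in> borel_measurable (lebesgue_on A)"
  using assms by (rule measurable_restrict_mono)

lemma ennreal_powr_measurable: "(\<lambda>y. ennreal_powr y r) \<in> borel_measurable borel"
  unfolding ennreal_powr_def by (intro measurable_If) auto

text \<open>
  Hoelder's inequality for the factorisation
  \<open>\<bar>x - x\<^sub>0\<bar>\<^sup>k \<bar>f\<bar> = (\<bar>x - x\<^sub>0\<bar>\<^sup>k / w\<^sup>1\<^sup>/\<^sup>p) (w\<^sup>1\<^sup>/\<^sup>p \<bar>f\<bar>)\<close>. The weight may vanish, but where it does the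
  critical quotient is infinite (away from \<open>x\<^sub>0\<close>), which noncriticality permits only on a null set.
\<close>

lemma noncritical_imp_weighted_bound:
  assumes w: "weight a b w" and p: "1 \<le> p"
    and x0: "x0 \<in> {a..b}" "x0 \<notin> critical_set a b p (real k) w"
  obtains \<epsilon> C where "0 < \<epsilon>" "0 \<le> C"
    "\<And>f. f \<in> Lp p (weighted_measure a b w) \<Longrightarrow>
       (\<integral>\<^sup>+x. ennreal (\<bar>x - x0\<bar> ^ k * \<bar>f x\<bar>) \<partial>lebesgue_on ({a<..<b} \<inter> ball x0 \<epsilon>))
         \<le> ennreal (C * Lp_norm p (weighted_measure a b w) f)"
proof -
  let ?M = "weighted_measure a b w" and ?L = "lebesgue_on {a<..<b}"
  let ?Q = "crit_quotient p (real k) w x0"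
  have num: "(if real k = 0 then 1 else \<bar>x - x0\<bar> powr real k) = \<bar>x - x0\<bar> ^ k" for x
    by (cases "x = x0") (auto simp: powr_realpow power_0_left)
  have Q: "?Q x = ennreal (\<bar>x - x0\<bar> ^ k) / ennreal (w x powr (1 / p))" for x
    unfolding crit_quotient_def num ..
  \<comment> \<open>A vanishing weight makes the quotient infinite: this is where the convention for division
    by zero is used.\<close>
  have Q0: "?Q x = \<infinity>" if "w x = 0" "\<bar>x - x0\<bar> ^ k \<noteq> 0" for x
  proof -
    have "0 < \<bar>x - x0\<bar> ^ k" using that(2) zero_le_power[of "\<bar>x - x0\<bar>" k] by linarith
    then show ?thesis using that(1) p by (simp add: Q ennreal_eq_0_iff del: zero_less_power_eq zero_less_power_abs_iff)
  qed
  have Qpos: "?Q x = ennreal (\<bar>x - x0\<bar> ^ k / w x powr (1 / p))" if "0 < w x" for x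
    using that by (simp add: Q divide_ennreal)
  from x0 obtain \<epsilon> where \<epsilon>: "0 < \<epsilon>" and fin:
    "(if p = 1 then esssup (lebesgue_on ({a..b} \<inter> ball x0 \<epsilon>)) ?Q
      else (\<integral>\<^sup>+x\<in>{a..b} \<inter> ball x0 \<epsilon>. ennreal_powr (?Q x) (holder_conj p) \<partial>lebesgue)) \<noteq> \<infinity>"
    unfolding critical_set_def by (auto split: if_splits)
  let ?S = "{a<..<b} \<inter> ball x0 \<epsilon>"
  let ?LS = "lebesgue_on ?S"
  have wm: "w \<in> borel_measurable ?L" by (rule weight_measurable[OF w])
  have wmS [measurable]: "w \<in> borel_measurable ?LS"
    by (rule borel_measurable_lebesgue_on_subset[OF wm]) auto
  define d where "d x = \<bar>x - x0\<bar> ^ k" for x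
  have [measurable]: "d \<in> borel_measurable ?LS"
    unfolding d_def by (intro measurable_restrict_space1 measurable_completion) simp
  have w0: "0 \<le> w x" if "x \<in> ?S" for x using w that by (auto simp: weight_def)
  have Qm [measurable]: "?Q \<in> borel_measurable ?LS"
    unfolding Q d_def[symmetric] by measurable
  have fm: "f \<in> borel_measurable ?LS" if "f \<in> Lp p ?M" for f
    by (rule borel_measurable_lebesgue_on_subset[OF Lp_measurable[OF that]]) auto
  show ?thesis
  proof (cases "p = 1")
    case True
    define K where "K = enn2real (esssup (lebesgue_on ({a..b} \<inter> ball x0 \<epsilon>)) ?Q)"
    have "AE x in lebesgue_on ({a..b} \<inter> ball x0 \<epsilon>). ?Q x \<le> ennreal K"
      using esssup_AE[where M="lebesgue_on ({a..b} \<inter> ball x0 \<epsilon>)" and f="?Q"] fin True by (simp add: K_def less_top)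
    then have "AE x in ?LS. ?Q x \<le> ennreal K"
      by (auto simp: AE_restrict_space_iff elim: eventually_mono)
    then have AE: "AE x in ?LS. \<bar>x - x0\<bar> ^ k \<le> K * w x"
      using AE_space
    proof eventually_elim
      case (elim x)
      then have "x \<in> ?S" by (simp add: space_restrict_space)
      then have "w x \<ge> 0" by (rule w0)
      show ?case
      proof (cases "w x = 0")
        case True
        with elim(1) Q0[of x] have "\<bar>x - x0\<bar> ^ k = 0"
          by (metis ennreal_less_top infinity_ennreal_def not_le)
        then show ?thesis using True by (metis mult_zero_right order_refl)
      next
        case False
        with \<open>w x \<ge> 0\<close> have "0 < w x" by simp
        with elim(1) Qpos[of x] \<open>p = 1\<close> show ?thesis
          by (simp add: K_def pos_divide_le_eq)
      qed
    qed
    show ?thesis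
    proof (rule that[OF \<epsilon>, of K])
      fix f assume f: "f \<in> Lp p ?M"
      have [measurable]: "f \<in> borel_measurable ?LS" by (rule fm[OF f])
      have "(\<integral>\<^sup>+x. ennreal (\<bar>x - x0\<bar> ^ k * \<bar>f x\<bar>) \<partial>?LS)
         \<le> (\<integral>\<^sup>+x. ennreal K * (ennreal (w x) * ennreal (\<bar>f x\<bar> powr p)) \<partial>?LS)"
      proof (intro nn_integral_mono_AE, use AE AE_space in eventually_elim)
        case (elim x)
        then have "0 \<le> w x" by (intro w0) (simp add: space_restrict_space)
        have "\<bar>x - x0\<bar> ^ k * \<bar>f x\<bar> \<le> K * w x * \<bar>f x\<bar>"
          using elim(1) by (intro mult_right_mono) auto
        then show ?case using True \<open>0 \<le> w x\<close>
          by (simp add: K_def mult.assoc flip: ennreal_mult'')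
      qed
      also have "\<dots> = ennreal K * (\<integral>\<^sup>+x. (ennreal (w x) * ennreal (\<bar>f x\<bar> powr p)) \<partial>?LS)"
        by (subst nn_integral_cmult) auto
      also have "\<dots> \<le> ennreal K * (\<integral>\<^sup>+x. (ennreal (w x) * ennreal (\<bar>f x\<bar> powr p)) \<partial>?L)"
        by (intro mult_left_mono nn_integral_lebesgue_on_subset) auto
      also have "\<dots> = ennreal (K * Lp_norm p ?M f)"
        unfolding nn_integral_Lp_norm[OF w p f] using True by (simp add: ennreal_mult'' K_def)
      finally show "(\<integral>\<^sup>+x. ennreal (\<bar>x - x0\<bar> ^ k * \<bar>f x\<bar>) \<partial>?LS) \<le> ennreal (K * Lp_norm p ?M f)" .
    qed (simp add: K_def)
  next
    case False
    with p have p1: "1 < p" by simp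
    let ?q = "holder_conj p"
    define T where "T = enn2real (\<integral>\<^sup>+x\<in>{a..b} \<inter> ball x0 \<epsilon>. ennreal_powr (?Q x) ?q \<partial>lebesgue)"
    have powr_m: "(\<lambda>x. ennreal_powr (?Q x) ?q) \<in> borel_measurable ?LS"
      by (rule measurable_compose[OF Qm ennreal_powr_measurable])
    have "(\<integral>\<^sup>+x. ennreal_powr (?Q x) ?q \<partial>?LS)
       \<le> (\<integral>\<^sup>+x\<in>{a..b} \<inter> ball x0 \<epsilon>. ennreal_powr (?Q x) ?q \<partial>lebesgue)"
      by (auto simp: nn_integral_restrict_space intro!: nn_integral_mono split: split_indicator)
    also have "\<dots> = ennreal T" using fin False by (simp add: T_def less_top)
    finally have T: "(\<integral>\<^sup>+x. ennreal_powr (?Q x) ?q \<partial>?LS) \<le> ennreal T" .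
    then have "AE x in ?LS. ennreal_powr (?Q x) ?q \<noteq> \<infinity>"
      by (intro nn_integral_PInf_AE powr_m) (auto simp: top_unique)
    moreover have "AE x in ?LS. x \<noteq> x0"
      using AE_completion[OF AE_lborel_singleton[of x0]]
      by (subst AE_restrict_space_iff) auto
    ultimately have AE: "AE x in ?LS. 0 < w x"
      using AE_space
    proof eventually_elim
      case (elim x)
      then have "0 \<le> w x" by (intro w0) (simp add: space_restrict_space)
      moreover have "?Q x = \<infinity>" if "w x = 0"
        using Q0[OF that] elim(2) by simp
      ultimately show ?case
        using elim(1) by (cases "w x = 0") (auto simp: ennreal_powr_def)
    qed
    \<comment> \<open>The maximum with \<open>0\<close> makes the functions nonnegative everywhere, also where nothing is
      known about the sign of \<open>w\<close>.\<close>
    define r where "r x = \<bar>x - x0\<bar> ^ k / (max 0 (w x)) powr (1 / p)" for x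
    have rm [measurable]: "r \<in> borel_measurable ?LS" unfolding r_def d_def[symmetric] by measurable
    have r_le: "AE x in ?LS. ennreal (r x powr ?q) \<le> ennreal_powr (?Q x) ?q"
      using AE
    proof eventually_elim
      case (elim x)
      then have "?Q x = ennreal (r x)" by (simp add: Qpos r_def)
      then show ?case by (simp add: ennreal_powr_def r_def)
    qed
    show ?thesis
    proof (rule that[OF \<epsilon>, of "T + 1"])
      fix f assume f: "f \<in> Lp p ?M"
      have [measurable]: "f \<in> borel_measurable ?LS" by (rule fm[OF f])
      define s where "s x = (max 0 (w x)) powr (1 / p) * \<bar>f x\<bar>" for x
      have sm: "s \<in> borel_measurable ?LS" unfolding s_def by measurable
      have "(\<integral>\<^sup>+x. ennreal (s x powr p) \<partial>?LS) \<le> ennreal (Lp_norm p ?M f powr p)"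
      proof -
        have "ennreal (s x powr p) = ennreal (w x) * ennreal (\<bar>f x\<bar> powr p)" if "x \<in> ?S" for x
          using w0[OF that] p by (simp add: s_def powr_mult powr_powr ennreal_mult'')
        then have "(\<integral>\<^sup>+x. ennreal (s x powr p) \<partial>?LS)
            = (\<integral>\<^sup>+x. ennreal (w x) * ennreal (\<bar>f x\<bar> powr p) \<partial>?LS)"
          by (intro nn_integral_cong) (simp add: space_restrict_space)
        also have "\<dots> \<le> (\<integral>\<^sup>+x. ennreal (w x) * ennreal (\<bar>f x\<bar> powr p) \<partial>?L)"
          by (intro nn_integral_lebesgue_on_subset) auto
        finally show ?thesis unfolding nn_integral_Lp_norm[OF w p f] .
      qed
      then have le: "(\<integral>\<^sup>+x. ennreal (r x * s x) \<partial>?LS)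
           \<le> ((\<integral>\<^sup>+x. ennreal (r x powr ?q) \<partial>?LS) + 1) * ennreal (Lp_norm p ?M f)"
        by (intro nn_integral_mult_le_of_powr p1 rm sm) (auto simp: r_def s_def)
      have "(\<integral>\<^sup>+x. ennreal (\<bar>x - x0\<bar> ^ k * \<bar>f x\<bar>) \<partial>?LS) = (\<integral>\<^sup>+x. ennreal (r x * s x) \<partial>?LS)"
        by (intro nn_integral_cong_AE, use AE in eventually_elim) (simp add: r_def s_def)
      also note le
      also have "(\<integral>\<^sup>+x. ennreal (r x powr ?q) \<partial>?LS) \<le> ennreal T"
        using nn_integral_mono_AE[OF r_le] T by (rule order_trans)
      finally show "(\<integral>\<^sup>+x. ennreal (\<bar>x - x0\<bar> ^ k * \<bar>f x\<bar>) \<partial>?LS) \<le> ennreal ((T + 1) * Lp_norm p ?M f)"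
        by (simp add: ennreal_mult'' T_def add_mono mult_right_mono)
    qed (simp add: T_def)
  qed
qed

section \<open>Hardy's inequality\<close>

text \<open>
  The pointwise form of Hardy's inequality. For every \<open>y\<close> in the outer half \<open>{r/2..r}\<close> the segment
  between \<open>x\<close> and \<open>y\<close> stays in \<open>{x/2..r}\<close>, on whichever side of \<open>x\<close> the point \<open>y\<close> lies, so
  \<open>\<bar>g x\<bar> \<le> \<bar>g y\<bar> + \<integral>\<^bsub>x/2\<^esub>\<^sup>r \<bar>g'\<bar>\<close>. Integrating over \<open>y\<close> replaces the value at \<open>y\<close> by a mean value.
\<close>

lemma nn_integral_average_le:
  fixes g g' :: "real \<Rightarrow> real"
  assumes deriv: "\<And>t. (g has_real_derivative g' t) (at t)" and cont: "continuous_on UNIV g'"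
    and x: "0 < x" "x < r"
  shows "ennreal (r / 2) * ennreal \<bar>g x\<bar>
     \<le> (\<integral>\<^sup>+y. ennreal \<bar>g y\<bar> * indicator {r/2..r} y \<partial>lborel)
       + ennreal (r / 2) * (\<integral>\<^sup>+t. ennreal \<bar>g' t\<bar> * indicator {x/2..r} t \<partial>lborel)"
proof -
  let ?D = "\<integral>\<^sup>+t. ennreal \<bar>g' t\<bar> * indicator {x/2..r} t \<partial>lborel"
  have [measurable]: "g' \<in> borel_measurable borel"
    using cont by (rule borel_measurable_continuous_onI)
  have "continuous_on UNIV g"
    using deriv by (meson DERIV_continuous continuous_at_imp_continuous_on)
  then have [measurable]: "g \<in> borel_measurable borel"
    by (rule borel_measurable_continuous_onI)
  have diff: "ennreal \<bar>g v - g u\<bar> \<le> ?D" if "x/2 \<le> u" "u \<le> v" "v \<le> r" for u v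
  proof -
    have "(g' has_integral (g v - g u)) {u..v}"
      using that deriv by (intro fundamental_theorem_of_calculus)
        (auto simp: has_real_derivative_iff_has_vector_derivative[symmetric] intro: has_field_derivative_at_within)
    moreover have int: "(\<lambda>t. \<bar>g' t\<bar>) integrable_on {u..v}"
      by (intro integrable_continuous_real continuous_intros continuous_on_subset[OF cont]) auto
    ultimately have "\<bar>g v - g u\<bar> \<le> integral {u..v} (\<lambda>t. \<bar>g' t\<bar>)"
      using integral_norm_bound_integral[of g' "{u..v}" "\<lambda>t. \<bar>g' t\<bar>"] by (auto simp: has_integral_integrable_integral)
    then have "ennreal \<bar>g v - g u\<bar> \<le> ennreal (integral {u..v} (\<lambda>t. \<bar>g' t\<bar>))" by (rule ennreal_leI)
    also have "\<dots> = (\<integral>\<^sup>+t. ennreal \<bar>g' t\<bar> * indicator {u..v} t \<partial>lborel)"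
    proof -
      have "set_integrable lborel {u..v} (\<lambda>t. \<bar>g' t\<bar>)"
        by (intro borel_integrable_atLeastAtMost' continuous_intros continuous_on_subset[OF cont]) auto
      from set_borel_integral_eq_integral(2)[OF this] this
      have "(\<integral>\<^sup>+t. ennreal (indicator {u..v} t * \<bar>g' t\<bar>) \<partial>lborel) = ennreal (integral {u..v} (\<lambda>t. \<bar>g' t\<bar>))"
        by (subst nn_integral_eq_integral) (auto simp: set_integrable_def set_lebesgue_integral_def)
      moreover have "ennreal (indicator {u..v} t * \<bar>g' t\<bar>) = ennreal \<bar>g' t\<bar> * indicator {u..v} t" for t
        by (simp split: split_indicator)
      ultimately show ?thesis by simp
    qed
    also have "\<dots> \<le> ?D"
      using that by (intro nn_integral_mono) (auto split: split_indicator)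
    finally show ?thesis .
  qed
  have le: "ennreal \<bar>g x\<bar> \<le> ennreal \<bar>g y\<bar> + ?D" if "y \<in> {r/2..r}" for y
  proof -
    have "ennreal \<bar>g x - g y\<bar> \<le> ?D"
      using diff[of x y] diff[of y x] that x by (cases "x \<le> y") (auto simp: abs_minus_commute)
    moreover have "ennreal \<bar>g x\<bar> \<le> ennreal \<bar>g y\<bar> + ennreal \<bar>g x - g y\<bar>"
      by (simp flip: ennreal_plus)
    ultimately show ?thesis by (meson add_left_mono order_trans)
  qed
  have "ennreal (r / 2) * ennreal \<bar>g x\<bar> = (\<integral>\<^sup>+y. ennreal \<bar>g x\<bar> * indicator {r/2..r} y \<partial>lborel)"
    using x by (simp add: nn_integral_cmult_indicator mult.commute)
  also have "\<dots> \<le> (\<integral>\<^sup>+y. ennreal \<bar>g y\<bar> * indicator {r/2..r} y + ?D * indicator {r/2..r} y \<partial>lborel)"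
    using le by (intro nn_integral_mono) (auto split: split_indicator)
  also have "\<dots> = (\<integral>\<^sup>+y. ennreal \<bar>g y\<bar> * indicator {r/2..r} y \<partial>lborel) + ?D * ennreal (r / 2)"
    using x by (subst nn_integral_add) (auto simp: nn_integral_cmult_indicator)
  finally show ?thesis by (simp only: mult.commute)
qed

text \<open>
  One power of \<open>t\<close> is gained for one derivative: multiply the pointwise estimate by \<open>x\<^sup>m\<close>, integrate
  over \<open>x\<close> and exchange the integrals. A fixed \<open>t\<close> is then weighted by
  \<open>\<integral> x\<^sup>m dx\<close> over \<open>x \<le> 2t\<close>, which is at most \<open>(2t)\<^sup>m\<^sup>+\<^sup>1\<close>.
\<close>

lemma hardy_step:
  fixes g g' :: "real \<Rightarrow> real" and m :: nat
  assumes deriv: "\<And>t. (g has_real_derivative g' t) (at t)" and cont: "continuous_on UNIV g'"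
    and r: "0 < r"
  shows "(\<integral>\<^sup>+t. ennreal (t ^ m * \<bar>g t\<bar>) * indicator {0<..<r} t \<partial>lborel)
     \<le> ennreal (2 * r ^ m) * (\<integral>\<^sup>+t. ennreal \<bar>g t\<bar> * indicator {r/2..r} t \<partial>lborel)
       + ennreal (2 ^ Suc m) * (\<integral>\<^sup>+t. ennreal (t ^ Suc m * \<bar>g' t\<bar>) * indicator {0<..<r} t \<partial>lborel)"
proof -
  have [measurable]: "g' \<in> borel_measurable borel"
    using cont by (rule borel_measurable_continuous_onI)
  have "continuous_on UNIV g"
    using deriv by (meson DERIV_continuous continuous_at_imp_continuous_on)
  then have [measurable]: "g \<in> borel_measurable borel"
    by (rule borel_measurable_continuous_onI)
  let ?A = "\<integral>\<^sup>+t. ennreal \<bar>g t\<bar> * indicator {r/2..r} t \<partial>lborel"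
  let ?D = "\<lambda>x. \<integral>\<^sup>+t. ennreal \<bar>g' t\<bar> * indicator {x/2..r} t \<partial>lborel"
  have pt: "ennreal (x ^ m * \<bar>g x\<bar>) * indicator {0<..<r} x
     \<le> ennreal (2 / r * r ^ m) * ?A * indicator {0<..<r} x + ennreal (x ^ m) * ?D x * indicator {0<..<r} x" for x
  proof (cases "x \<in> {0<..<r}")
    case True
    have "ennreal \<bar>g x\<bar> = ennreal (2 / r) * (ennreal (r / 2) * ennreal \<bar>g x\<bar>)"
      using r by (simp flip: ennreal_mult'' mult.assoc)
    also have "\<dots> \<le> ennreal (2 / r) * (?A + ennreal (r / 2) * ?D x)"
      using True by (intro mult_left_mono nn_integral_average_le deriv cont) auto
    also have "\<dots> = ennreal (2 / r) * ?A + ?D x"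
      using r by (simp add: distrib_left flip: ennreal_mult'' mult.assoc)
    finally have *: "ennreal \<bar>g x\<bar> \<le> ennreal (2 / r) * ?A + ?D x" .
    have "ennreal (x ^ m * \<bar>g x\<bar>) = ennreal (x ^ m) * ennreal \<bar>g x\<bar>"
      using True by (simp add: ennreal_mult'')
    also have "\<dots> \<le> ennreal (x ^ m) * (ennreal (2 / r) * ?A + ?D x)"
      by (intro mult_left_mono *) auto
    also have "\<dots> = ennreal (x ^ m) * ennreal (2 / r) * ?A + ennreal (x ^ m) * ?D x"
      by (simp add: distrib_left mult.assoc)
    also have "ennreal (x ^ m) * ennreal (2 / r) \<le> ennreal (2 / r * r ^ m)"
      using True r power_mono[of x r m]
      by (auto simp: mult.commute mult_left_mono simp flip: ennreal_mult'' intro!: ennreal_leI divide_right_mono)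
    finally show ?thesis using True by (simp add: add_right_mono mult_right_mono)
  qed simp
  \<comment> \<open>After the exchange of the integrals, \<open>x/2 \<le> t\<close> confines \<open>x\<close> to \<open>{0<..2*t}\<close>.\<close>
  have "(\<integral>\<^sup>+x. ennreal (x ^ m) * ?D x * indicator {0<..<r} x \<partial>lborel)
     = (\<integral>\<^sup>+x. (\<integral>\<^sup>+t. ennreal (x ^ m) * indicator {0<..<r} x * (ennreal \<bar>g' t\<bar> * indicator {x/2..r} t) \<partial>lborel) \<partial>lborel)"
    by (intro nn_integral_cong, subst nn_integral_cmult) (auto simp: mult_ac)
  also have "\<dots> = (\<integral>\<^sup>+t. (\<integral>\<^sup>+x. ennreal (x ^ m) * indicator {0<..<r} x * (ennreal \<bar>g' t\<bar> * indicator {x/2..r} t) \<partial>lborel) \<partial>lborel)"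
    by (rule lborel_pair.Fubini') (simp add: indicator_def)
  also have "\<dots> \<le> (\<integral>\<^sup>+t. ennreal (2 ^ Suc m) * (ennreal (t ^ Suc m * \<bar>g' t\<bar>) * indicator {0<..r} t) \<partial>lborel)"
  proof (intro nn_integral_mono)
    fix t :: real
    have "(\<integral>\<^sup>+x. ennreal (x ^ m) * indicator {0<..<r} x * (ennreal \<bar>g' t\<bar> * indicator {x/2..r} t) \<partial>lborel)
       \<le> (\<integral>\<^sup>+x. ennreal ((2 * t) ^ m) * ennreal \<bar>g' t\<bar> * indicator {0<..r} t * indicator {0<..2*t} x \<partial>lborel)"
    proof (intro nn_integral_mono)
      fix x :: real
      show "ennreal (x ^ m) * indicator {0<..<r} x * (ennreal \<bar>g' t\<bar> * indicator {x/2..r} t)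
          \<le> ennreal ((2 * t) ^ m) * ennreal \<bar>g' t\<bar> * indicator {0<..r} t * indicator {0<..2*t} x"
      proof (cases "x \<in> {0<..<r} \<and> t \<in> {x/2..r}")
        case True
        then have "x ^ m \<le> (2 * t) ^ m" by (intro power_mono) auto
        then have "ennreal (x ^ m) * ennreal \<bar>g' t\<bar> \<le> ennreal ((2 * t) ^ m) * ennreal \<bar>g' t\<bar>"
          by (intro mult_right_mono ennreal_leI) auto
        then show ?thesis using True by (simp add: indicator_def)
      qed (auto simp: indicator_def)
    qed
    also have "\<dots> = ennreal (2 ^ Suc m) * (ennreal (t ^ Suc m * \<bar>g' t\<bar>) * indicator {0<..r} t)"
    proof (cases "t \<in> {0<..r}")
      case True
      then have "(\<integral>\<^sup>+x. ennreal ((2 * t) ^ m) * ennreal \<bar>g' t\<bar> * indicator {0<..r} t * indicator {0<..2*t} x \<partial>lborel)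
          = ennreal ((2 * t) ^ m * \<bar>g' t\<bar> * (2 * t))"
        by (simp add: nn_integral_cmult_indicator ennreal_mult)
      also have "(2 * t) ^ m * \<bar>g' t\<bar> * (2 * t) = 2 ^ Suc m * (t ^ Suc m * \<bar>g' t\<bar>)"
        by (simp add: power_mult_distrib)
      finally show ?thesis using True by (simp add: ennreal_mult)
    qed simp
    finally show "(\<integral>\<^sup>+x. ennreal (x ^ m) * indicator {0<..<r} x * (ennreal \<bar>g' t\<bar> * indicator {x/2..r} t) \<partial>lborel)
       \<le> ennreal (2 ^ Suc m) * (ennreal (t ^ Suc m * \<bar>g' t\<bar>) * indicator {0<..r} t)" .
  qed
  also have "\<dots> = ennreal (2 ^ Suc m) * (\<integral>\<^sup>+t. ennreal (t ^ Suc m * \<bar>g' t\<bar>) * indicator {0<..r} t \<partial>lborel)"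
    by (subst nn_integral_cmult) auto
  also have "(\<integral>\<^sup>+t. ennreal (t ^ Suc m * \<bar>g' t\<bar>) * indicator {0<..r} t \<partial>lborel)
    = (\<integral>\<^sup>+t. ennreal (t ^ Suc m * \<bar>g' t\<bar>) * indicator {0<..<r} t \<partial>lborel)"
    by (intro nn_integral_cong_AE, use AE_lborel_singleton[of r] in eventually_elim) (auto split: split_indicator)
  finally have D: "(\<integral>\<^sup>+x. ennreal (x ^ m) * ?D x * indicator {0<..<r} x \<partial>lborel)
    \<le> ennreal (2 ^ Suc m) * (\<integral>\<^sup>+t. ennreal (t ^ Suc m * \<bar>g' t\<bar>) * indicator {0<..<r} t \<partial>lborel)" .
  have Dm: "(\<lambda>x. ?D x) \<in> borel_measurable borel"
    by (rule lborel.borel_measurable_nn_integral[of _ borel, simplified]) (simp add: indicator_def)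
  have "(\<integral>\<^sup>+t. ennreal (t ^ m * \<bar>g t\<bar>) * indicator {0<..<r} t \<partial>lborel)
    \<le> (\<integral>\<^sup>+x. ennreal (2 / r * r ^ m) * ?A * indicator {0<..<r} x + ennreal (x ^ m) * ?D x * indicator {0<..<r} x \<partial>lborel)"
    by (intro nn_integral_mono pt)
  also have "\<dots> = ennreal (2 / r * r ^ m) * ?A * ennreal r + (\<integral>\<^sup>+x. ennreal (x ^ m) * ?D x * indicator {0<..<r} x \<partial>lborel)"
    using Dm r by (subst nn_integral_add) (auto simp: nn_integral_cmult_indicator)
  also have "ennreal (2 / r * r ^ m) * ?A * ennreal r = ennreal (2 / r * r ^ m) * ennreal r * ?A"
    by (simp add: mult_ac)
  also have "ennreal (2 / r * r ^ m) * ennreal r = ennreal (2 * r ^ m)"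
    using r by (simp flip: ennreal_mult'')
  finally show ?thesis using D by (meson add_left_mono order_trans)
qed

lemma test_functions_has_deriv:
  assumes "U \<in> test_functions"
  shows "((deriv ^^ j) U has_real_derivative (deriv ^^ Suc j) U t) (at t)"
  using assms by (simp add: test_functions_def DERIV_deriv_iff_field_differentiable)

lemma test_functions_continuous:
  assumes "U \<in> test_functions"
  shows "continuous_on A ((deriv ^^ j) U)"
  using test_functions_has_deriv[OF assms]
  by (meson DERIV_continuous continuous_at_imp_continuous_on)

text \<open>
  The sign \<open>\<sigma>\<close> is the direction in which a function is followed from the critical point, so that
  both sides can be treated at once. The induction runs downwards from
  \<open>m = k\<close>. The constant must be uniform in the functions \<open>G\<close>, which is why the quantifiers over them
  are kept inside the induction.
\<close>

lemma hardy_iterated: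
  fixes r :: real and k m :: nat
  assumes r: "0 < r" and "m \<le> k"
  shows "\<exists>K\<ge>0. \<forall>(G :: nat \<Rightarrow> real \<Rightarrow> real) \<sigma>.
     \<bar>\<sigma>\<bar> = 1 \<longrightarrow> (\<forall>j t. (G j has_real_derivative \<sigma> * G (Suc j) t) (at t)) \<longrightarrow>
     (\<integral>\<^sup>+t. ennreal (t ^ m * \<bar>G m t\<bar>) * indicator {0<..<r} t \<partial>lborel)
       \<le> ennreal K * (\<Sum>j\<le>k. \<integral>\<^sup>+t. ennreal (t ^ k * \<bar>G j t\<bar>) * indicator {0<..<r} t \<partial>lborel)"
  using \<open>m \<le> k\<close>
proof (induction m rule: inc_induct)
  case base
  have "(\<integral>\<^sup>+t. ennreal (t ^ k * \<bar>G k t\<bar>) * indicator {0<..<r} t \<partial>lborel)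
     \<le> (\<Sum>j\<le>k. \<integral>\<^sup>+t. ennreal (t ^ k * \<bar>G j t\<bar>) * indicator {0<..<r} t \<partial>lborel)" for G :: "nat \<Rightarrow> real \<Rightarrow> real"
    by (rule member_le_sum) auto
  then show ?case by (intro exI[of _ 1]) auto
next
  case (step m)
  let ?J = "\<lambda>G j. \<integral>\<^sup>+t. ennreal (t ^ k * \<bar>G j t\<bar>) * indicator {0<..<r} t \<partial>lborel"
  let ?A = "\<lambda>(G :: nat \<Rightarrow> real \<Rightarrow> real) m. \<integral>\<^sup>+t. ennreal (t ^ m * \<bar>G m t\<bar>) * indicator {0<..<r} t \<partial>lborel"
  from step.IH obtain K where K: "0 \<le> K"
    "\<And>(G :: nat \<Rightarrow> real \<Rightarrow> real) \<sigma>. \<bar>\<sigma>\<bar> = 1 \<Longrightarrow> (\<And>j t. (G j has_real_derivative \<sigma> * G (Suc j) t) (at t)) \<Longrightarrow>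
       ?A G (Suc m) \<le> ennreal K * (\<Sum>j\<le>k. ?J G j)"
    by blast
  define K' where "K' = 2 * r ^ m * (2 / r) ^ k + 2 ^ Suc m * K"
  show ?case
  proof (intro exI[of _ K'] conjI allI impI)
    show "0 \<le> K'" using r K by (simp add: K'_def)
  next
    fix G :: "nat \<Rightarrow> real \<Rightarrow> real" and \<sigma> :: real
    assume \<sigma>: "\<bar>\<sigma>\<bar> = 1" and "\<forall>j t. (G j has_real_derivative \<sigma> * G (Suc j) t) (at t)"
    then have D: "\<And>j t. (G j has_real_derivative \<sigma> * G (Suc j) t) (at t)" by blast
    have cont: "continuous_on UNIV (G j)" for j
      using D by (meson DERIV_continuous continuous_at_imp_continuous_on)
    have [measurable]: "G j \<in> borel_measurable borel" for j
      using cont[of j] by (rule borel_measurable_continuous_onI)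
    have \<sigma>_abs: "\<bar>\<sigma> * y\<bar> = \<bar>y\<bar>" for y using \<sigma> by (simp add: abs_mult)
    have "?A G m \<le> ennreal (2 * r ^ m) * (\<integral>\<^sup>+t. ennreal \<bar>G m t\<bar> * indicator {r/2..r} t \<partial>lborel)
        + ennreal (2 ^ Suc m) * (\<integral>\<^sup>+t. ennreal (t ^ Suc m * \<bar>G (Suc m) t\<bar>) * indicator {0<..<r} t \<partial>lborel)"
      using hardy_step[OF D _ r, of m m] by (simp only: \<sigma>_abs continuous_intros cont)
    also have "(\<integral>\<^sup>+t. ennreal (t ^ Suc m * \<bar>G (Suc m) t\<bar>) * indicator {0<..<r} t \<partial>lborel)
        \<le> ennreal K * (\<Sum>j\<le>k. ?J G j)"
      by (rule K(2)[of \<sigma> G, OF \<sigma> D])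
    \<comment> \<open>On the outer half \<open>1 \<le> 2t/r\<close>, so any power of \<open>t\<close> can be inserted.\<close>
    also have "(\<integral>\<^sup>+t. ennreal \<bar>G m t\<bar> * indicator {r/2..r} t \<partial>lborel)
        \<le> (\<integral>\<^sup>+t. ennreal ((2 / r) ^ k) * (ennreal (t ^ k * \<bar>G m t\<bar>) * indicator {0<..<r} t) \<partial>lborel)"
    proof (intro nn_integral_mono_AE, use AE_lborel_singleton[of r] in eventually_elim)
      case (elim t)
      show ?case
      proof (cases "t \<in> {r/2..r}")
        case True
        then have "1 ^ k \<le> ((2 / r) * t) ^ k"
          using r by (intro power_mono) (auto simp: field_simps)
        then have "1 * \<bar>G m t\<bar> \<le> ((2 / r) * t) ^ k * \<bar>G m t\<bar>"
          by (intro mult_right_mono) auto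
        also have "\<dots> = (2 / r) ^ k * (t ^ k * \<bar>G m t\<bar>)"
          by (simp add: power_mult_distrib power_divide)
        finally have "ennreal \<bar>G m t\<bar> \<le> ennreal ((2 / r) ^ k * (t ^ k * \<bar>G m t\<bar>))"
          by (intro ennreal_leI) simp
        also have "\<dots> = ennreal ((2 / r) ^ k) * ennreal (t ^ k * \<bar>G m t\<bar>)"
          using r by (intro ennreal_mult') simp
        finally show ?thesis using True elim r by (simp add: indicator_def)
      qed simp
    qed
    also have "\<dots> = ennreal ((2 / r) ^ k) * ?J G m"
      by (subst nn_integral_cmult) auto
    also have "?J G m \<le> (\<Sum>j\<le>k. ?J G j)"
      using step.hyps by (intro member_le_sum) auto
    finally have "?A G m \<le> ennreal (2 * r ^ m) * (ennreal ((2 / r) ^ k) * (\<Sum>j\<le>k. ?J G j))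
        + ennreal (2 ^ Suc m) * (ennreal K * (\<Sum>j\<le>k. ?J G j))"
      by (simp add: add_mono mult_left_mono)
    also have "\<dots> = (ennreal (2 * r ^ m) * ennreal ((2 / r) ^ k) + ennreal (2 ^ Suc m) * ennreal K) * (\<Sum>j\<le>k. ?J G j)"
      by (simp only: mult.assoc distrib_right)
    also have "ennreal (2 * r ^ m) * ennreal ((2 / r) ^ k) + ennreal (2 ^ Suc m) * ennreal K = ennreal K'"
      unfolding K'_def using r K(1) by (simp add: ennreal_plus ennreal_mult' del: power_Suc)
    finally show "?A G m \<le> ennreal K' * (\<Sum>j\<le>k. ?J G j)" .
  qed
qed

text \<open>
  The substitution \<open>x = x\<^sub>0 + \<sigma> t\<close> turns the right (\<open>\<sigma> = 1\<close>) or left (\<open>\<sigma> = -1\<close>) half of a ball into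
  \<open>{0<..<r}\<close>; each derivative contributes one factor \<open>\<sigma>\<close>.
\<close>

lemma hardy_one_sided:
  fixes r x0 \<sigma> :: real and k :: nat
  assumes r: "0 < r" and \<sigma>: "\<bar>\<sigma>\<bar> = 1"
  shows "\<exists>K\<ge>0. \<forall>U\<in>test_functions.
     (\<integral>\<^sup>+x. ennreal \<bar>U x\<bar> * indicator {x. 0 < \<sigma> * (x - x0) \<and> \<sigma> * (x - x0) < r} x \<partial>lborel)
       \<le> ennreal K * (\<Sum>j\<le>k. \<integral>\<^sup>+x. ennreal (\<bar>x - x0\<bar> ^ k * \<bar>(deriv ^^ j) U x\<bar>)
            * indicator {x. 0 < \<sigma> * (x - x0) \<and> \<sigma> * (x - x0) < r} x \<partial>lborel)"
proof -
  let ?S = "{x. 0 < \<sigma> * (x - x0) \<and> \<sigma> * (x - x0) < r}"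
  obtain K where K: "0 \<le> K"
    "\<And>(G :: nat \<Rightarrow> real \<Rightarrow> real). (\<And>j t. (G j has_real_derivative \<sigma> * G (Suc j) t) (at t)) \<Longrightarrow>
     (\<integral>\<^sup>+t. ennreal (t ^ 0 * \<bar>G 0 t\<bar>) * indicator {0<..<r} t \<partial>lborel)
       \<le> ennreal K * (\<Sum>j\<le>k. \<integral>\<^sup>+t. ennreal (t ^ k * \<bar>G j t\<bar>) * indicator {0<..<r} t \<partial>lborel)"
    using hardy_iterated[OF r, of 0 k] \<sigma> by blast
  have \<sigma>2: "\<sigma> * (\<sigma> * t) = t" for t using \<sigma> by (cases "\<sigma> \<ge> 0") auto
  have subst: "(\<integral>\<^sup>+x. ennreal (\<bar>x - x0\<bar> ^ n * \<bar>f x\<bar>) * indicator ?S x \<partial>lborel)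
      = (\<integral>\<^sup>+t. ennreal (t ^ n * \<bar>f (x0 + \<sigma> * t)\<bar>) * indicator {0<..<r} t \<partial>lborel)"
    if [measurable]: "f \<in> borel_measurable borel" for f n
  proof -
    have "(\<integral>\<^sup>+x. ennreal (\<bar>x - x0\<bar> ^ n * \<bar>f x\<bar>) * indicator ?S x \<partial>lborel)
       = (\<integral>\<^sup>+t. ennreal (\<bar>(x0 + \<sigma> * t) - x0\<bar> ^ n * \<bar>f (x0 + \<sigma> * t)\<bar>) * indicator ?S (x0 + \<sigma> * t) \<partial>lborel)"
      using \<sigma> by (subst nn_integral_real_affine[where c=\<sigma> and t=x0]) auto
    also have "\<dots> = (\<integral>\<^sup>+t. ennreal (t ^ n * \<bar>f (x0 + \<sigma> * t)\<bar>) * indicator {0<..<r} t \<partial>lborel)"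
      using \<sigma> by (intro nn_integral_cong) (auto simp: \<sigma>2 abs_mult split: split_indicator)
    finally show ?thesis .
  qed
  have "(\<integral>\<^sup>+x. ennreal \<bar>U x\<bar> * indicator ?S x \<partial>lborel)
       \<le> ennreal K * (\<Sum>j\<le>k. \<integral>\<^sup>+x. ennreal (\<bar>x - x0\<bar> ^ k * \<bar>(deriv ^^ j) U x\<bar>) * indicator ?S x \<partial>lborel)"
    if U: "U \<in> test_functions" for U
  proof -
    define G where "G j t = (deriv ^^ j) U (x0 + \<sigma> * t)" for j t
    have "(G j has_real_derivative \<sigma> * G (Suc j) t) (at t)" for j t
    proof -
      have "((\<lambda>t. (deriv ^^ j) U (x0 + \<sigma> * t)) has_real_derivative (deriv ^^ Suc j) U (x0 + \<sigma> * t) * \<sigma>) (at t)"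
        by (rule DERIV_chain2[OF test_functions_has_deriv[OF U]]) (auto intro!: derivative_eq_intros)
      then show ?thesis by (simp only: G_def[abs_def] mult.commute)
    qed
    from K(2)[of G, OF this] show ?thesis
      using subst[of U 0] subst[of "(deriv ^^ j) U" k for j] test_functions_continuous[OF U, of UNIV]
        test_functions_continuous[OF U, of UNIV 0]
      by (simp add: borel_measurable_continuous_onI G_def)
  qed
  with K(1) show ?thesis by blast
qed

text \<open>
  A half-ball is estimated only if it meets the interval. If \<open>x\<^sub>0\<close> is an endpoint, the other half lies
  outside and contributes nothing.
\<close>

lemma hardy_ball:
  fixes a b x0 \<epsilon> :: real and k :: nat
  assumes x0: "x0 \<in> {a..b}" and \<epsilon>: "0 < \<epsilon>" and "a < b"
  obtains r K where "0 < r" "r \<le> \<epsilon>" "0 \<le> K"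
    "\<And>U. U \<in> test_functions \<Longrightarrow>
     (\<integral>\<^sup>+x. ennreal \<bar>U x\<bar> \<partial>lebesgue_on ({a<..<b} \<inter> ball x0 r))
       \<le> ennreal K * (\<Sum>j\<le>k. \<integral>\<^sup>+x. ennreal (\<bar>x - x0\<bar> ^ k * \<bar>(deriv ^^ j) U x\<bar>)
            \<partial>lebesgue_on ({a<..<b} \<inter> ball x0 \<epsilon>))"
proof -
  \<comment> \<open>Every half-ball that meets the interval has to lie in it; at an endpoint the default \<open>\<epsilon>\<close>
    imposes no condition on the half-ball outside.\<close>
  define r where "r = min \<epsilon> (min (if x0 < b then b - x0 else \<epsilon>) (if a < x0 then x0 - a else \<epsilon>))"
  have r: "0 < r" "r \<le> \<epsilon>" using \<epsilon> by (auto simp: r_def)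
  let ?S = "\<lambda>\<sigma>. {x. 0 < \<sigma> * (x - x0) \<and> \<sigma> * (x - x0) < r}"
  let ?B = "{a<..<b} \<inter> ball x0 \<epsilon>"
  have "\<exists>K\<ge>0. \<forall>U\<in>test_functions.
      (\<integral>\<^sup>+x. ennreal \<bar>U x\<bar> * indicator (?S \<sigma> \<inter> {a<..<b}) x \<partial>lborel)
       \<le> ennreal K * (\<Sum>j\<le>k. \<integral>\<^sup>+x. ennreal (\<bar>x - x0\<bar> ^ k * \<bar>(deriv ^^ j) U x\<bar>)
            * indicator ?B x \<partial>lborel)" if \<sigma>: "\<sigma> = 1 \<or> \<sigma> = -1" for \<sigma>
  proof (cases "(\<sigma> = 1 \<and> x0 < b) \<or> (\<sigma> = -1 \<and> a < x0)")
    case True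
    then have sub: "?S \<sigma> \<subseteq> ?B" using x0 by (auto simp: r_def dist_real_def)
    obtain K where K: "0 \<le> K" "\<And>U. U \<in> test_functions \<Longrightarrow>
       (\<integral>\<^sup>+x. ennreal \<bar>U x\<bar> * indicator (?S \<sigma>) x \<partial>lborel)
         \<le> ennreal K * (\<Sum>j\<le>k. \<integral>\<^sup>+x. ennreal (\<bar>x - x0\<bar> ^ k * \<bar>(deriv ^^ j) U x\<bar>)
              * indicator (?S \<sigma>) x \<partial>lborel)"
      using hardy_one_sided[OF r(1), of \<sigma> x0 k] \<sigma> by auto
    have "(\<integral>\<^sup>+x. ennreal \<bar>U x\<bar> * indicator (?S \<sigma> \<inter> {a<..<b}) x \<partial>lborel)
       \<le> ennreal K * (\<Sum>j\<le>k. \<integral>\<^sup>+x. ennreal (\<bar>x - x0\<bar> ^ k * \<bar>(deriv ^^ j) U x\<bar>)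
            * indicator ?B x \<partial>lborel)" if U: "U \<in> test_functions" for U
    proof -
      have "(\<integral>\<^sup>+x. ennreal \<bar>U x\<bar> * indicator (?S \<sigma> \<inter> {a<..<b}) x \<partial>lborel)
        \<le> (\<integral>\<^sup>+x. ennreal \<bar>U x\<bar> * indicator (?S \<sigma>) x \<partial>lborel)"
        by (intro nn_integral_mono) (auto split: split_indicator)
      also note K(2)[OF U]
      also have "(\<Sum>j\<le>k. \<integral>\<^sup>+x. ennreal (\<bar>x - x0\<bar> ^ k * \<bar>(deriv ^^ j) U x\<bar>) * indicator (?S \<sigma>) x \<partial>lborel)
         \<le> (\<Sum>j\<le>k. \<integral>\<^sup>+x. ennreal (\<bar>x - x0\<bar> ^ k * \<bar>(deriv ^^ j) U x\<bar>) * indicator ?B x \<partial>lborel)"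
        using sub by (intro sum_mono nn_integral_mono mult_left_mono) (auto split: split_indicator)
      finally show ?thesis by (simp add: mult_left_mono)
    qed
    with K(1) show ?thesis by blast
  next
    case False
    then have "?S \<sigma> \<inter> {a<..<b} = {}" using x0 \<sigma> by auto
    then show ?thesis by (intro exI[of _ 0]) simp
  qed
  from this[of 1] this[of "-1"] obtain K1 K2 where K: "0 \<le> K1" "0 \<le> K2"
    and K1: "\<And>U. U \<in> test_functions \<Longrightarrow> (\<integral>\<^sup>+x. ennreal \<bar>U x\<bar> * indicator (?S 1 \<inter> {a<..<b}) x \<partial>lborel)
       \<le> ennreal K1 * (\<Sum>j\<le>k. \<integral>\<^sup>+x. ennreal (\<bar>x - x0\<bar> ^ k * \<bar>(deriv ^^ j) U x\<bar>) * indicator ?B x \<partial>lborel)"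
    and K2: "\<And>U. U \<in> test_functions \<Longrightarrow> (\<integral>\<^sup>+x. ennreal \<bar>U x\<bar> * indicator (?S (-1) \<inter> {a<..<b}) x \<partial>lborel)
       \<le> ennreal K2 * (\<Sum>j\<le>k. \<integral>\<^sup>+x. ennreal (\<bar>x - x0\<bar> ^ k * \<bar>(deriv ^^ j) U x\<bar>) * indicator ?B x \<partial>lborel)"
    by blast
  show ?thesis
  proof (rule that[OF r, of "K1 + K2"])
    fix U assume U: "U \<in> test_functions"
    have [measurable]: "U \<in> borel_measurable borel"
      using test_functions_continuous[OF U, of UNIV 0] by (simp add: borel_measurable_continuous_onI)
    let ?Z = "\<Sum>j\<le>k. \<integral>\<^sup>+x. ennreal (\<bar>x - x0\<bar> ^ k * \<bar>(deriv ^^ j) U x\<bar>) * indicator ?B x \<partial>lborel"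
    have "(\<integral>\<^sup>+x. ennreal \<bar>U x\<bar> \<partial>lebesgue_on ({a<..<b} \<inter> ball x0 r))
      = (\<integral>\<^sup>+x. ennreal \<bar>U x\<bar> * indicator ({a<..<b} \<inter> ball x0 r) x \<partial>lborel)"
      by (simp add: nn_integral_restrict_space nn_integral_completion)
    also have "\<dots> \<le> (\<integral>\<^sup>+x. ennreal \<bar>U x\<bar> * indicator (?S 1 \<inter> {a<..<b}) x
           + ennreal \<bar>U x\<bar> * indicator (?S (-1) \<inter> {a<..<b}) x \<partial>lborel)"
      by (intro nn_integral_mono_AE, use AE_lborel_singleton[of x0] in eventually_elim)
         (auto simp: dist_real_def split: split_indicator)
    also have "\<dots> = (\<integral>\<^sup>+x. ennreal \<bar>U x\<bar> * indicator (?S 1 \<inter> {a<..<b}) x \<partial>lborel)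
           + (\<integral>\<^sup>+x. ennreal \<bar>U x\<bar> * indicator (?S (-1) \<inter> {a<..<b}) x \<partial>lborel)"
      by (rule nn_integral_add) auto
    also have "\<dots> \<le> ennreal K1 * ?Z + ennreal K2 * ?Z"
      by (intro add_mono K1 K2 U)
    also have "\<dots> = ennreal (K1 + K2) * ?Z"
      using K by (simp add: distrib_right)
    finally show "(\<integral>\<^sup>+x. ennreal \<bar>U x\<bar> \<partial>lebesgue_on ({a<..<b} \<inter> ball x0 r))
       \<le> ennreal (K1 + K2) * (\<Sum>j\<le>k. \<integral>\<^sup>+x. ennreal (\<bar>x - x0\<bar> ^ k * \<bar>(deriv ^^ j) U x\<bar>) \<partial>lebesgue_on ?B)"
      by (simp add: nn_integral_restrict_space nn_integral_completion)
  qed (use K in simp)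
qed

section \<open>Passing from test functions to tangential derivatives\<close>

lemma Lp_diff:
  assumes "1 \<le> p" "f \<in> Lp p M" "g \<in> Lp p M"
  shows "(\<lambda>x. f x - g x) \<in> Lp p M"
proof -
  have [measurable]: "f \<in> borel_measurable M" "g \<in> borel_measurable M"
    using assms by (auto simp: Lp_def)
  have le: "\<bar>s - t\<bar> powr p \<le> 2 powr p * (\<bar>s\<bar> powr p + \<bar>t\<bar> powr p)" for s t :: real
  proof -
    have "\<bar>s - t\<bar> powr p \<le> (2 * max \<bar>s\<bar> \<bar>t\<bar>) powr p"
      using assms(1) by (intro powr_mono2) auto
    also have "\<dots> = 2 powr p * (max \<bar>s\<bar> \<bar>t\<bar>) powr p"
      by (simp add: powr_mult)
    also have "\<dots> \<le> 2 powr p * (\<bar>s\<bar> powr p + \<bar>t\<bar> powr p)"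
      by (intro mult_left_mono) (auto simp: max_def)
    finally show ?thesis .
  qed
  have "integrable M (\<lambda>x. 2 powr p * (\<bar>f x\<bar> powr p + \<bar>g x\<bar> powr p))"
    using assms by (auto simp: Lp_def)
  then have "integrable M (\<lambda>x. \<bar>f x - g x\<bar> powr p)"
    by (rule Bochner_Integration.integrable_bound) (auto simp: le)
  then show ?thesis by (simp add: Lp_def)
qed

lemma finite_weighted_measure:
  assumes "weight a b w"
  shows "finite_measure (weighted_measure a b w)"
proof
  have "integrable (lebesgue_on {a<..<b}) w"
    using assms by (simp add: weight_def set_integrable_def integrable_restrict_space)
  then have "(\<integral>\<^sup>+x. ennreal (norm (w x)) \<partial>lebesgue_on {a<..<b}) < \<infinity>"
    by (simp add: integrable_iff_bounded)
  moreover have "(\<integral>\<^sup>+x. ennreal (w x) \<partial>lebesgue_on {a<..<b})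
      \<le> (\<integral>\<^sup>+x. ennreal (norm (w x)) \<partial>lebesgue_on {a<..<b})"
    by (intro nn_integral_mono ennreal_leI) simp
  moreover have "emeasure (weighted_measure a b w) (space (weighted_measure a b w))
      = (\<integral>\<^sup>+x. ennreal (w x) \<partial>lebesgue_on {a<..<b})"
    using weight_measurable[OF assms] unfolding weighted_measure_def
    by (subst emeasure_density) (auto intro!: nn_integral_cong simp: space_restrict_space)
  ultimately show "emeasure (weighted_measure a b w) (space (weighted_measure a b w)) \<noteq> \<infinity>"
    by (metis le_less_trans less_irrefl)
qed

lemma test_functions_Lp:
  assumes w: "weight a b w" and p: "1 \<le> p" and U: "U \<in> test_functions"
  shows "(deriv ^^ j) U \<in> Lp p (weighted_measure a b w)"
proof -
  let ?f = "(deriv ^^ j) U" and ?M = "weighted_measure a b w"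
  interpret finite_measure ?M by (rule finite_weighted_measure[OF w])
  have "compact (?f ` {a..b})"
    by (intro compact_continuous_image test_functions_continuous[OF U]) simp
  then obtain B where B: "\<And>x. x \<in> {a..b} \<Longrightarrow> \<bar>?f x\<bar> \<le> B"
    using compact_imp_bounded bounded_iff by (metis imageI real_norm_def)
  have "?f \<in> borel_measurable lebesgue"
    by (intro measurable_completion)
       (simp add: borel_measurable_continuous_onI[OF test_functions_continuous[OF U]])
  then have [measurable]: "?f \<in> borel_measurable ?M"
    by (simp add: measurable_restrict_space1)
  have "integrable ?M (\<lambda>x. \<bar>?f x\<bar> powr p)"
  proof (rule integrable_const_bound[where B = "B powr p"])
    have "\<bar>?f x\<bar> powr p \<le> B powr p" if "x \<in> space ?M" for x
      using that B[of x] p by (intro powr_mono2) (auto simp: weighted_measure_def space_restrict_space)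
    then show "AE x in ?M. norm (\<bar>?f x\<bar> powr p) \<le> B powr p" by (intro AE_I2) simp
  qed measurable
  then show ?thesis by (simp add: Lp_def)
qed

text \<open>
  Fatou's lemma in the form in which bounds on test functions are carried over to their limits.
\<close>

lemma nn_integral_abs_le_limit:
  fixes F :: "nat \<Rightarrow> 'a \<Rightarrow> real"
  assumes [measurable]: "\<And>n. F n \<in> borel_measurable M"
    and lim: "AE x in M. (\<lambda>n. F n x) \<longlonglongrightarrow> f x"
    and bound: "\<And>n. (\<integral>\<^sup>+x. ennreal \<bar>F n x\<bar> \<partial>M) \<le> ennreal (B n)" and B: "B \<longlonglongrightarrow> L"
  shows "(\<integral>\<^sup>+x. ennreal \<bar>f x\<bar> \<partial>M) \<le> ennreal L"
proof -
  have "(\<integral>\<^sup>+x. ennreal \<bar>f x\<bar> \<partial>M) = (\<integral>\<^sup>+x. liminf (\<lambda>n. ennreal \<bar>F n x\<bar>) \<partial>M)"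
  proof (intro nn_integral_cong_AE, use lim in eventually_elim)
    case (elim x)
    then have "(\<lambda>n. ennreal \<bar>F n x\<bar>) \<longlonglongrightarrow> ennreal \<bar>f x\<bar>"
      by (intro tendsto_ennrealI tendsto_rabs)
    then show ?case by (rule lim_imp_Liminf[OF sequentially_bot, symmetric])
  qed
  also have "\<dots> \<le> liminf (\<lambda>n. \<integral>\<^sup>+x. ennreal \<bar>F n x\<bar> \<partial>M)"
    by (rule nn_integral_liminf) measurable
  also have "\<dots> \<le> liminf (\<lambda>n. ennreal (B n))"
    by (intro Liminf_mono always_eventually allI bound)
  also have "\<dots> = ennreal L"
    using B by (intro lim_imp_Liminf tendsto_ennrealI) auto
  finally show ?thesis .
qed

text \<open>
  The witnesses \<open>v\<close> of tangential derivatives start at index \<open>1\<close>. Putting \<open>u\<close> at index \<open>0\<close> makes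
  functions and derivatives uniform in \<open>j\<close>.
\<close>

lemma has_tangential_derivs_approx:
  assumes "has_tangential_derivs a b p w m u v"
  shows "\<exists>U. (\<forall>h. U h \<in> test_functions) \<and>
    (\<forall>j\<le>m. (v(0 := u)) j \<in> Lp p (weighted_measure a b w)) \<and>
    (\<forall>j\<le>m. (\<lambda>h. Lp_norm p (weighted_measure a b w) (\<lambda>x. (deriv ^^ j) (U h) x - (v(0 := u)) j x)) \<longlonglongrightarrow> 0)"
proof -
  let ?M = "weighted_measure a b w"
  from assms obtain U where U: "\<And>h. U h \<in> test_functions" and u: "u \<in> Lp p ?M"
    and v: "\<And>j. j \<in> {1..m} \<Longrightarrow> v j \<in> Lp p ?M" and Uu: "tendsto_Lp p ?M U u"
    and Uv: "\<And>j. j \<in> {1..m} \<Longrightarrow> tendsto_Lp p ?M (\<lambda>h. (deriv ^^ j) (U h)) (v j)"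
    unfolding has_tangential_derivs_def Let_def by blast
  have "(v(0 := u)) j \<in> Lp p ?M"
    and "(\<lambda>h. Lp_norm p ?M (\<lambda>x. (deriv ^^ j) (U h) x - (v(0 := u)) j x)) \<longlonglongrightarrow> 0" if "j \<le> m" for j
    using that u v[of j] Uu Uv[of j] unfolding tendsto_Lp_def by (cases "j = 0"; simp)+
  with U show ?thesis by blast
qed

text \<open>
  The triangle inequality is applied in the weighted space \<open>L\<^sup>1\<close>, after Hoelder, so that
  Minkowski's inequality in \<open>L\<^sup>p(M)\<close> is avoided. The same weighted bound for \<open>U h - u\<close> yields the almost
  everywhere convergent subsequence for Fatou's lemma: dividing by \<open>\<bar>x - x\<^sub>0\<bar>\<^sup>k\<close> is harmless off \<open>x\<^sub>0\<close>.
\<close>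

lemma noncritical_imp_tangential_bound:
  assumes w: "weight a b w" and p: "1 \<le> p" and ab: "a < b"
    and x0: "x0 \<in> {a..b}" "x0 \<notin> critical_set a b p (real k) w"
  obtains r K where "0 < r" "0 \<le> K"
    "\<And>u v. has_tangential_derivs a b p w k u v \<Longrightarrow>
       (\<integral>\<^sup>+x. ennreal \<bar>u x\<bar> \<partial>lebesgue_on ({a<..<b} \<inter> ball x0 r))
         \<le> ennreal (K * (\<Sum>j\<le>k. Lp_norm p (weighted_measure a b w) ((v(0 := u)) j)))"
proof -
  let ?M = "weighted_measure a b w"
  obtain \<epsilon> C where \<epsilon>: "0 < \<epsilon>" and C: "0 \<le> C"
    and wb: "\<And>f. f \<in> Lp p ?M \<Longrightarrow>
       (\<integral>\<^sup>+x. ennreal (\<bar>x - x0\<bar> ^ k * \<bar>f x\<bar>) \<partial>lebesgue_on ({a<..<b} \<inter> ball x0 \<epsilon>))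
         \<le> ennreal (C * Lp_norm p ?M f)"
    using noncritical_imp_weighted_bound[OF w p x0] by blast
  obtain r K where r: "0 < r" "r \<le> \<epsilon>" and K: "0 \<le> K"
    and hardy: "\<And>U. U \<in> test_functions \<Longrightarrow>
     (\<integral>\<^sup>+x. ennreal \<bar>U x\<bar> \<partial>lebesgue_on ({a<..<b} \<inter> ball x0 r))
       \<le> ennreal K * (\<Sum>j\<le>k. \<integral>\<^sup>+x. ennreal (\<bar>x - x0\<bar> ^ k * \<bar>(deriv ^^ j) U x\<bar>)
            \<partial>lebesgue_on ({a<..<b} \<inter> ball x0 \<epsilon>))"
    using hardy_ball[OF x0(1) \<epsilon> ab, of k] by blast
  let ?S = "{a<..<b} \<inter> ball x0 \<epsilon>" and ?R = "{a<..<b} \<inter> ball x0 r"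
  define d where "d x = \<bar>x - x0\<bar> ^ k" for x
  have d0: "0 \<le> d x" for x by (simp add: d_def)
  have [measurable]: "d \<in> borel_measurable (lebesgue_on ?S)"
    unfolding d_def by (intro measurable_restrict_space1 measurable_completion) simp
  have Lpm: "f \<in> borel_measurable (lebesgue_on ?S)" if "f \<in> Lp p ?M" for f
    by (rule borel_measurable_lebesgue_on_subset[OF Lp_measurable[OF that]]) auto
  show ?thesis
  proof (rule that[OF r(1), of "K * C"])
    fix u v assume D: "has_tangential_derivs a b p w k u v"
    obtain U where U: "\<And>h. U h \<in> test_functions"
      and V0: "\<And>j. j \<le> k \<Longrightarrow> (v(0 := u)) j \<in> Lp p ?M"
      and N0: "\<And>j. j \<le> k \<Longrightarrow> (\<lambda>h. Lp_norm p ?M (\<lambda>x. (deriv ^^ j) (U h) x - (v(0 := u)) j x)) \<longlonglongrightarrow> 0"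
      using has_tangential_derivs_approx[OF D] by blast
    define V where "V = v(0 := u)"
    define N where "N h j = Lp_norm p ?M (\<lambda>x. (deriv ^^ j) (U h) x - V j x)" for h j
    note V = V0[folded V_def] and N = N0[folded V_def, folded N_def]
    have u: "u \<in> Lp p ?M" using V0[of 0] by simp
    have DU: "(deriv ^^ j) (U h) \<in> Lp p ?M" for j h
      by (rule test_functions_Lp[OF w p U])
    have diff: "(\<integral>\<^sup>+x. ennreal (d x * \<bar>(deriv ^^ j) (U h) x - V j x\<bar>) \<partial>lebesgue_on ?S) \<le> ennreal (C * N h j)"
      if "j \<le> k" for h j
      using wb[OF Lp_diff[OF p DU V[OF that]]] by (simp add: d_def N_def)
    have bound: "(\<integral>\<^sup>+x. ennreal (d x * \<bar>(deriv ^^ j) (U h) x\<bar>) \<partial>lebesgue_on ?S)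
        \<le> ennreal (C * (N h j + Lp_norm p ?M (V j)))" if j: "j \<le> k" for h j
    proof -
      have [measurable]: "(deriv ^^ j) (U h) \<in> borel_measurable (lebesgue_on ?S)"
          "V j \<in> borel_measurable (lebesgue_on ?S)"
        by (intro Lpm DU V j)+
      have "(\<integral>\<^sup>+x. ennreal (d x * \<bar>(deriv ^^ j) (U h) x\<bar>) \<partial>lebesgue_on ?S)
         \<le> (\<integral>\<^sup>+x. ennreal (d x * \<bar>(deriv ^^ j) (U h) x - V j x\<bar>) + ennreal (d x * \<bar>V j x\<bar>) \<partial>lebesgue_on ?S)"
      proof (intro nn_integral_mono)
        fix x
        have "d x * \<bar>(deriv ^^ j) (U h) x\<bar> \<le> d x * (\<bar>(deriv ^^ j) (U h) x - V j x\<bar> + \<bar>V j x\<bar>)"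
          by (intro mult_left_mono d0) linarith
        then show "ennreal (d x * \<bar>(deriv ^^ j) (U h) x\<bar>)
          \<le> ennreal (d x * \<bar>(deriv ^^ j) (U h) x - V j x\<bar>) + ennreal (d x * \<bar>V j x\<bar>)"
          using d0[of x] by (simp add: distrib_left ennreal_leI flip: ennreal_plus)
      qed
      also have "\<dots> = (\<integral>\<^sup>+x. ennreal (d x * \<bar>(deriv ^^ j) (U h) x - V j x\<bar>) \<partial>lebesgue_on ?S)
          + (\<integral>\<^sup>+x. ennreal (d x * \<bar>V j x\<bar>) \<partial>lebesgue_on ?S)"
        by (rule nn_integral_add) measurable
      also have "\<dots> \<le> ennreal (C * N h j) + ennreal (C * Lp_norm p ?M (V j))"
        using diff[OF j, of h] wb[OF V[OF j]] by (intro add_mono) (simp_all add: d_def)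
      also have "\<dots> = ennreal (C * (N h j + Lp_norm p ?M (V j)))"
        using C by (simp add: N_def distrib_left flip: ennreal_plus)
      finally show ?thesis .
    qed
    have Ubound: "(\<integral>\<^sup>+x. ennreal \<bar>U h x\<bar> \<partial>lebesgue_on ?R)
        \<le> ennreal (K * (\<Sum>j\<le>k. C * (N h j + Lp_norm p ?M (V j))))" for h
    proof -
      have "(\<integral>\<^sup>+x. ennreal \<bar>U h x\<bar> \<partial>lebesgue_on ?R)
         \<le> ennreal K * (\<Sum>j\<le>k. \<integral>\<^sup>+x. ennreal (d x * \<bar>(deriv ^^ j) (U h) x\<bar>) \<partial>lebesgue_on ?S)"
        using hardy[OF U] by (simp add: d_def)
      also have "\<dots> \<le> ennreal K * (\<Sum>j\<le>k. ennreal (C * (N h j + Lp_norm p ?M (V j))))"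
        by (intro mult_left_mono sum_mono bound) auto
      also have "\<dots> = ennreal (K * (\<Sum>j\<le>k. C * (N h j + Lp_norm p ?M (V j))))"
        using K C by (subst sum_ennreal) (simp_all add: N_def ennreal_mult'[symmetric])
      finally show ?thesis .
    qed
    have um: "u \<in> borel_measurable (lebesgue_on ?S)" "\<And>h. U h \<in> borel_measurable (lebesgue_on ?S)"
      using Lpm[OF u] Lpm[OF DU[of 0]] by auto
    note um [measurable]
    have int: "integrable (lebesgue_on ?S) (\<lambda>x. d x * (U h x - u x))"
      and intle: "(\<integral>x. norm (d x * (U h x - u x)) \<partial>lebesgue_on ?S) \<le> C * N h 0" for h
    proof -
      have eq: "(\<integral>\<^sup>+x. ennreal (norm (d x * (U h x - u x))) \<partial>lebesgue_on ?S) \<le> ennreal (C * N h 0)"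
        using diff[of 0 h] d0 by (simp add: V_def abs_mult)
      then show "integrable (lebesgue_on ?S) (\<lambda>x. d x * (U h x - u x))"
        by (intro integrableI_bounded) (auto simp: le_less_trans)
      show "(\<integral>x. norm (d x * (U h x - u x)) \<partial>lebesgue_on ?S) \<le> C * N h 0"
        using eq C by (subst integral_eq_nn_integral) (auto simp: N_def intro!: enn2real_leI)
    qed
    have "(\<lambda>h. \<integral>x. norm (d x * (U h x - u x)) \<partial>lebesgue_on ?S) \<longlonglongrightarrow> 0"
    proof (rule tendsto_sandwich[OF _ _ tendsto_const])
      show "(\<lambda>h. C * N h 0) \<longlonglongrightarrow> 0" using tendsto_mult_right_zero[OF N[of 0], of C] by simp
    qed (use intle in simp_all)
    from tendsto_L1_AE_subseq[OF int this] obtain s :: "nat \<Rightarrow> nat" where s: "strict_mono s"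
      and AE: "AE x in lebesgue_on ?S. (\<lambda>n. d x * (U (s n) x - u x)) \<longlonglongrightarrow> 0"
      by blast
    have AEx: "AE x in lebesgue_on ?S. x \<noteq> x0"
      using AE_completion[OF AE_lborel_singleton[of x0]] by (subst AE_restrict_space_iff) auto
    have "AE x in lebesgue_on ?S. (\<lambda>n. U (s n) x) \<longlonglongrightarrow> u x"
      using AE AEx
    proof eventually_elim
      case (elim x)
      then have "d x \<noteq> 0" by (simp add: d_def)
      with elim(1) have "(\<lambda>n. U (s n) x - u x) \<longlonglongrightarrow> 0"
        using tendsto_mult_left_iff[of "d x" "\<lambda>n. U (s n) x - u x" 0] by simp
      then show ?case by (simp add: LIM_zero_iff)
    qed
    then have lim: "AE x in lebesgue_on ?R. (\<lambda>n. U (s n) x) \<longlonglongrightarrow> u x"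
      using r(2) by (auto simp: AE_restrict_space_iff elim!: eventually_mono)
    have Blim: "(\<lambda>n. K * (\<Sum>j\<le>k. C * (N (s n) j + Lp_norm p ?M (V j))))
        \<longlonglongrightarrow> K * (\<Sum>j\<le>k. C * (0 + Lp_norm p ?M (V j)))"
      using LIMSEQ_subseq_LIMSEQ[OF N s, unfolded o_def] by (intro tendsto_intros) auto
    have Um: "U h \<in> borel_measurable (lebesgue_on ?R)" for h
      by (rule borel_measurable_lebesgue_on_subset[OF um(2)]) (use r(2) in auto)
    have "(\<integral>\<^sup>+x. ennreal \<bar>u x\<bar> \<partial>lebesgue_on ?R)
        \<le> ennreal (K * (\<Sum>j\<le>k. C * (0 + Lp_norm p ?M (V j))))"
      by (rule nn_integral_abs_le_limit[OF Um lim Ubound Blim])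
    then show "(\<integral>\<^sup>+x. ennreal \<bar>u x\<bar> \<partial>lebesgue_on ?R)
        \<le> ennreal (K * C * (\<Sum>j\<le>k. Lp_norm p ?M ((v(0 := u)) j)))"
      by (simp add: V_def sum_distrib_left mult.assoc)
  qed (use K C in simp)
qed

section \<open>Limits of derivatives of vanishing sequences\<close>

text \<open>
  The positive and the negative part of \<open>G\<close> are densities of finite measures that agree on all
  half-lines, hence everywhere.
\<close>

lemma AE_zero_of_tail_integrals:
  fixes G :: "real \<Rightarrow> real"
  assumes G: "integrable lborel G"
    and zero: "\<And>x. (\<integral>t. indicator {x<..} t * G t \<partial>lborel) = 0"
  shows "AE t in lborel. G t = 0"
proof -
  have [measurable]: "G \<in> borel_measurable borel" using G by auto
  let ?P = "\<lambda>t. max 0 (G t)" and ?N = "\<lambda>t. max 0 (- G t)"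
  have int: "integrable lborel (\<lambda>t. indicator {x<..} t * ?P t)" "integrable lborel (\<lambda>t. indicator {x<..} t * ?N t)" for x
    by (rule Bochner_Integration.integrable_bound[OF G]; auto split: split_indicator)+
  have P: "emeasure (density lborel (\<lambda>t. ennreal (?P t))) {x<..} = ennreal (\<integral>t. indicator {x<..} t * ?P t \<partial>lborel)" for x
    by (subst emeasure_density, simp, simp, subst nn_integral_eq_integral[OF int(1), symmetric])
       (auto intro!: nn_integral_cong split: split_indicator)
  have N: "emeasure (density lborel (\<lambda>t. ennreal (?N t))) {x<..} = ennreal (\<integral>t. indicator {x<..} t * ?N t \<partial>lborel)" for x
    by (subst emeasure_density, simp, simp, subst nn_integral_eq_integral[OF int(2), symmetric])
       (auto intro!: nn_integral_cong split: split_indicator)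
  have "(\<integral>t. indicator {x<..} t * ?P t \<partial>lborel) = (\<integral>t. indicator {x<..} t * ?N t \<partial>lborel)" for x
  proof -
    have "(\<integral>t. indicator {x<..} t * ?P t \<partial>lborel) - (\<integral>t. indicator {x<..} t * ?N t \<partial>lborel)
       = (\<integral>t. indicator {x<..} t * ?P t - indicator {x<..} t * ?N t \<partial>lborel)"
      by (rule Bochner_Integration.integral_diff[OF int, symmetric])
    also have "\<dots> = (\<integral>t. indicator {x<..} t * G t \<partial>lborel)"
      by (intro Bochner_Integration.integral_cong) (auto split: split_indicator)
    finally show ?thesis using zero by simp
  qed
  then have "density lborel (\<lambda>t. ennreal (?P t)) = density lborel (\<lambda>t. ennreal (?N t))"
    by (intro measure_eqI_lessThan) (simp_all add: P N)
  then have "AE t in lborel. ennreal (?P t) = ennreal (?N t)"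
    by (subst (asm) sigma_finite_measure.density_unique_iff[OF sigma_finite_lborel]) auto
  then show ?thesis
    by eventually_elim (simp add: max_def split: if_splits)
qed

lemma AE_dense:
  fixes c d :: real
  assumes "c < d" and AE: "AE x in lborel. x \<in> {c<..<d} \<longrightarrow> P x"
  shows "{c..d} \<subseteq> closure {x \<in> {c<..<d}. P x}"
proof -
  have ex: "\<exists>z\<in>{u<..<v}. P z" if "c \<le> u" "u < v" "v \<le> d" for u v
  proof (rule ccontr)
    assume none: "\<not> (\<exists>z\<in>{u<..<v}. P z)"
    have "AE x in lborel. x \<notin> {u<..<v}"
      using AE by eventually_elim (use none that in auto)
    then have "emeasure lborel {u<..<v} = 0"
      by (subst (asm) AE_iff_measurable[of "{u<..<v}"]) auto
    with that show False by simp
  qed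
  show ?thesis
  proof
    fix x assume x: "x \<in> {c..d}"
    show "x \<in> closure {x \<in> {c<..<d}. P x}"
      unfolding closure_approachable
    proof (intro allI impI)
      fix e :: real assume "0 < e"
      obtain z where "z \<in> {max c (x - e)<..<min d (x + e)}" "P z"
        using ex[of "max c (x - e)" "min d (x + e)"] x \<open>0 < e\<close> \<open>c < d\<close> by auto
      then show "\<exists>y\<in>{x \<in> {c<..<d}. P x}. dist y x < e"
        by (intro bexI[of _ z]) (auto simp: dist_real_def)
    qed
  qed
qed

text \<open>
  The endpoints need only be taken from a set of full measure: such a set is dense, and the
  indefinite integral of \<open>G\<close> is continuous.
\<close>

lemma AE_zero_of_interval_integrals:
  fixes G :: "real \<Rightarrow> real"
  assumes "c < d" and G: "integrable lborel G" and supp: "\<And>t. t \<notin> {c<..<d} \<Longrightarrow> G t = 0"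
    and AE: "AE x in lborel. x \<in> {c<..<d} \<longrightarrow> P x"
    and zero: "\<And>x y. x < y \<Longrightarrow> x \<in> {c<..<d} \<Longrightarrow> y \<in> {c<..<d} \<Longrightarrow> P x \<Longrightarrow> P y \<Longrightarrow>
        (\<integral>t. indicator {x..y} t * G t \<partial>lborel) = 0"
  shows "AE t in lborel. G t = 0"
proof -
  define H where "H x = integral {c..x} G" for x
  let ?D = "{x \<in> {c<..<d}. P x}"
  have set_int: "set_integrable lborel {x..y} G" for x y :: real
    using integrable_mult_indicator[of "{x..y}" lborel G] G by (simp add: set_integrable_def)
  have eq: "(\<integral>t. indicator {x..y} t * G t \<partial>lborel) = integral {x..y} G" and ion: "G integrable_on {x..y}" for x y :: real
    using set_borel_integral_eq_integral[OF set_int[of x y]] by (auto simp: set_lebesgue_integral_def)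
  have comb: "integral {x..y} G = H y - H x" if "c \<le> x" "x \<le> y" for x y
    using Henstock_Kurzweil_Integration.integral_combine[OF that ion] by (simp add: H_def)
  have dense: "{c..d} \<subseteq> closure ?D" by (rule AE_dense[OF \<open>c < d\<close> AE])
  moreover have "closure ?D \<subseteq> {c..d}"
    by (rule closure_minimal) auto
  ultimately have clos: "closure ?D = {c..d}" by auto
  obtain z where z: "z \<in> ?D"
    using clos \<open>c < d\<close> by (metis atLeastatMost_empty_iff2 closure_empty equals0I not_le order_less_imp_le)
  have Hz: "H x = H z" if "x \<in> ?D" for x
  proof (cases x z rule: linorder_cases)
    case less
    then show ?thesis using zero[of x z] comb[of x z] that z by (auto simp: eq)
  next
    case greater
    then show ?thesis using zero[of z x] comb[of z x] that z by (auto simp: eq)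
  qed simp
  have "continuous_on (closure ?D) H"
    unfolding clos H_def by (rule indefinite_integral_continuous_1[OF ion])
  then have "H x = H z" if "x \<in> {c..d}" for x
    using continuous_constant_on_closure[of ?D H "H z" x] Hz that clos by blast
  moreover have "H c = 0" by (simp add: H_def)
  ultimately have H0: "H x = 0" if "x \<in> {c..d}" for x
    using that \<open>c < d\<close> by (metis atLeastAtMost_iff less_imp_le order_refl)
  have "(\<integral>t. indicator {x<..} t * G t \<partial>lborel) = 0" for x
  proof -
    have "(\<integral>t. indicator {x<..} t * G t \<partial>lborel) = (\<integral>t. indicator {max c x..d} t * G t \<partial>lborel)"
    proof (intro integral_cong_AE)
      show "AE t in lborel. indicator {x<..} t * G t = indicator {max c x..d} t * G t"
        using AE_lborel_singleton[of x]
      proof eventually_elim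
        case (elim t)
        then show ?case using supp[of t] by (cases "t \<in> {c<..<d}") (auto split: split_indicator)
      qed
    qed (use G in auto)
    also have "\<dots> = 0"
    proof (cases "max c x \<le> d")
      case True
      then show ?thesis using comb[of "max c x" d] H0[of d] H0[of "max c x"] \<open>c < d\<close> by (simp add: eq)
    qed simp
    finally show ?thesis .
  qed
  with G show ?thesis by (rule AE_zero_of_tail_integrals)
qed

text \<open>
  If \<open>F n \<rightarrow> 0\<close> and \<open>F' n \<rightarrow> g\<close> in \<open>L\<^sup>1\<close>, then \<open>g\<close> is the weak derivative of \<open>0\<close>. Concretely,
  \<open>\<integral>\<^sub>x\<^sup>y g\<close> is the limit of \<open>F n y - F n x\<close>, and this limit is \<open>0\<close> for almost all \<open>x\<close> and \<open>y\<close> along a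
  subsequence. The rates \<open>\<alpha>\<close> and \<open>\<beta>\<close> express the two convergences.
\<close>

lemma derivative_limit_zero:
  fixes F F' :: "nat \<Rightarrow> real \<Rightarrow> real" and g :: "real \<Rightarrow> real"
  assumes "c < d"
    and deriv: "\<And>n t. (F n has_real_derivative F' n t) (at t)" and cont: "\<And>n. continuous_on UNIV (F' n)"
    and g: "g \<in> borel_measurable (lebesgue_on {c<..<d})"
    and F_le: "\<And>n. (\<integral>\<^sup>+x. ennreal \<bar>F n x\<bar> \<partial>lebesgue_on {c<..<d}) \<le> ennreal (\<alpha> n)"
    and F'_le: "\<And>n. (\<integral>\<^sup>+x. ennreal \<bar>F' n x - g x\<bar> \<partial>lebesgue_on {c<..<d}) \<le> ennreal (\<beta> n)"
    and \<alpha>: "\<alpha> \<longlonglongrightarrow> 0" "\<And>n. 0 \<le> \<alpha> n" and \<beta>: "\<beta> \<longlonglongrightarrow> 0" "\<And>n. 0 \<le> \<beta> n"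
  shows "AE x in lebesgue_on {c<..<d}. g x = 0"
proof -
  let ?J = "{c<..<d}"
  have [measurable]: "F' n \<in> borel_measurable borel" for n
    using cont by (rule borel_measurable_continuous_onI)
  have "continuous_on UNIV (F n)" for n
    using deriv by (meson DERIV_continuous continuous_at_imp_continuous_on)
  then have Fm [measurable]: "F n \<in> borel_measurable borel" for n
    by (rule borel_measurable_continuous_onI)
  have "(\<lambda>x. indicator ?J x * g x) \<in> borel_measurable lebesgue"
    using g by (simp add: borel_measurable_restrict_space_iff)
  then obtain G0 where [measurable]: "G0 \<in> borel_measurable lborel"
    and G0: "AE x in lborel. indicator ?J x * g x = G0 x"
    using completion_ex_borel_measurable_real by blast
  define G where "G x = indicator ?J x * G0 x" for x
  have [measurable]: "G \<in> borel_measurable borel" unfolding G_def by measurable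
  have gG: "AE x in lborel. x \<in> ?J \<longrightarrow> g x = G x"
    using G0 by eventually_elim (auto simp: G_def)
  have F_le': "(\<integral>\<^sup>+x. ennreal \<bar>indicator ?J x * F n x\<bar> \<partial>lborel) \<le> ennreal (\<alpha> n)" for n
  proof -
    have "(\<integral>\<^sup>+x. ennreal \<bar>indicator ?J x * F n x\<bar> \<partial>lborel) = (\<integral>\<^sup>+x. ennreal \<bar>F n x\<bar> \<partial>lebesgue_on ?J)"
      by (auto simp: nn_integral_restrict_space nn_integral_completion intro!: nn_integral_cong split: split_indicator)
    with F_le show ?thesis by simp
  qed
  have F'_le': "(\<integral>\<^sup>+x. ennreal \<bar>indicator ?J x * (F' n x - G x)\<bar> \<partial>lborel) \<le> ennreal (\<beta> n)" for n
  proof -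
    have "(\<integral>\<^sup>+x. ennreal \<bar>indicator ?J x * (F' n x - G x)\<bar> \<partial>lborel) = (\<integral>\<^sup>+x. ennreal \<bar>F' n x - g x\<bar> * indicator ?J x \<partial>lborel)"
      by (intro nn_integral_cong_AE, use gG in eventually_elim) (auto split: split_indicator)
    also have "\<dots> = (\<integral>\<^sup>+x. ennreal \<bar>F' n x - g x\<bar> \<partial>lebesgue_on ?J)"
      by (simp add: nn_integral_restrict_space nn_integral_completion)
    finally show ?thesis using F'_le by simp
  qed
  have intF': "integrable lborel (\<lambda>x. indicator A x * F' n x)" if "A \<subseteq> {c..d}" "A \<in> sets borel" for n A
  proof -
    have "set_integrable lborel {c..d} (F' n)"
      by (intro borel_integrable_atLeastAtMost' continuous_on_subset[OF cont]) auto
    then have "set_integrable lborel A (F' n)"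
      by (rule set_integrable_subset) (use that in auto)
    then show ?thesis by (simp add: set_integrable_def)
  qed
  have intdiff: "integrable lborel (\<lambda>x. indicator ?J x * (F' n x - G x))" for n
    using F'_le'[of n] by (intro integrableI_bounded) (auto simp: le_less_trans)
  have "integrable lborel (\<lambda>x. indicator ?J x * F' 0 x - indicator ?J x * (F' 0 x - G x))"
    by (intro Bochner_Integration.integrable_diff intF' intdiff) auto
  also have "(\<lambda>x. indicator ?J x * F' 0 x - indicator ?J x * (F' 0 x - G x)) = G"
    by (auto simp: G_def fun_eq_iff split: split_indicator)
  finally have G: "integrable lborel G" .
  have intF: "integrable lborel (\<lambda>x. indicator ?J x * F n x)" for n
    using F_le'[of n] by (intro integrableI_bounded) (auto simp: le_less_trans)
  have "(\<integral>x. norm (indicator ?J x * F n x) \<partial>lborel) \<le> \<alpha> n" for n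
    using F_le'[of n] \<alpha>(2) by (subst integral_eq_nn_integral) (auto intro!: enn2real_leI)
  then have "(\<lambda>n. \<integral>x. norm (indicator ?J x * F n x) \<partial>lborel) \<longlonglongrightarrow> 0"
    by (intro tendsto_sandwich[OF _ _ tendsto_const \<alpha>(1)]) auto
  from tendsto_L1_AE_subseq[OF intF this] obtain s :: "nat \<Rightarrow> nat" where s: "strict_mono s"
    and AE: "AE x in lborel. (\<lambda>n. indicator ?J x * F (s n) x) \<longlonglongrightarrow> 0"
    by blast
  have "AE t in lborel. G t = 0"
  proof (rule AE_zero_of_interval_integrals[OF \<open>c < d\<close> G])
    show "AE x in lborel. x \<in> ?J \<longrightarrow> (\<lambda>n. F (s n) x) \<longlonglongrightarrow> 0"
      using AE by eventually_elim auto
    fix x y assume xy: "x < y" "x \<in> ?J" "y \<in> ?J"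
      and lim: "(\<lambda>n. F (s n) x) \<longlonglongrightarrow> 0" "(\<lambda>n. F (s n) y) \<longlonglongrightarrow> 0"
    let ?I = "{x..y}"
    have sub: "?I \<subseteq> ?J" using xy by auto
    have intG: "integrable lborel (\<lambda>t. indicator ?I t * G t)"
      using G by (auto intro: integrable_mult_indicator[where 'b=real, simplified])
    have le: "\<bar>(F n y - F n x) - (\<integral>t. indicator ?I t * G t \<partial>lborel)\<bar> \<le> \<beta> n" for n
    proof -
      have int': "integrable lborel (\<lambda>t. indicator ?I t * F' n t)"
        using xy by (intro intF') auto
      have "(\<integral>t. indicator ?I t * F' n t \<partial>lborel) = F n y - F n x"
        using integral_FTC_Icc_real[of x y "F n" "F' n"] xy deriv cont[of n]
        by (simp add: mult.commute continuous_on_eq_continuous_at)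
      then have "ennreal \<bar>(F n y - F n x) - (\<integral>t. indicator ?I t * G t \<partial>lborel)\<bar>
          = ennreal (norm (\<integral>t. indicator ?I t * F' n t - indicator ?I t * G t \<partial>lborel))"
        using int' intG by simp
      also have "\<dots> \<le> (\<integral>\<^sup>+t. ennreal (norm (indicator ?I t * F' n t - indicator ?I t * G t)) \<partial>lborel)"
        by (intro integral_norm_bound_ennreal Bochner_Integration.integrable_diff int' intG)
      also have "\<dots> \<le> (\<integral>\<^sup>+x. ennreal \<bar>indicator ?J x * (F' n x - G x)\<bar> \<partial>lborel)"
        using sub by (intro nn_integral_mono) (auto split: split_indicator)
      also note F'_le'
      finally show ?thesis using \<beta>(2) by simp
    qed
    have "(\<lambda>n. (F (s n) y - F (s n) x) - (\<integral>t. indicator ?I t * G t \<partial>lborel)) \<longlonglongrightarrow> 0"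
    proof (rule Lim_null_comparison)
      show "(\<lambda>n. \<beta> (s n)) \<longlonglongrightarrow> 0"
        using LIMSEQ_subseq_LIMSEQ[OF \<beta>(1) s] by (simp add: o_def)
    qed (simp add: le)
    moreover have "(\<lambda>n. (F (s n) y - F (s n) x) - (\<integral>t. indicator ?I t * G t \<partial>lborel))
        \<longlonglongrightarrow> (0 - 0) - (\<integral>t. indicator ?I t * G t \<partial>lborel)"
      by (intro tendsto_intros lim)
    ultimately show "(\<integral>t. indicator ?I t * G t \<partial>lborel) = 0"
      by (auto dest: LIMSEQ_unique)
  qed (auto simp: G_def)
  with gG have "AE x in lborel. x \<in> ?J \<longrightarrow> g x = 0"
    by eventually_elim auto
  then show ?thesis
    by (subst AE_restrict_space_iff) (auto intro: AE_completion)
qed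

section \<open>Uniqueness of tangential derivatives\<close>

text \<open>
  Near a point that is noncritical of order \<open>0\<close>, convergence in \<open>L\<^sup>p(M)\<close> implies convergence in
  \<open>L\<^sup>1\<close>. For the difference of two approximating sequences, the limits of the \<open>j\<close>-th and \<open>(j+1)\<close>-st
  derivatives are therefore linked by \<open>derivative_limit_zero\<close>, and induction on \<open>j\<close> applies.
\<close>

lemma tangential_derivs_agree_locally:
  assumes w: "weight a b w" and p: "1 \<le> p"
    and x0: "x0 \<in> {a<..<b}" "x0 \<notin> critical_set a b p 0 w"
    and D: "has_tangential_derivs a b p w m u v" and D': "has_tangential_derivs a b p w n u v'"
    and j: "j \<le> m" "j \<le> n"
  shows "\<exists>r>0. AE x in lebesgue_on ({a<..<b} \<inter> ball x0 r). (v(0 := u)) j x = (v'(0 := u)) j x"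
proof -
  let ?M = "weighted_measure a b w"
  obtain r C where r: "0 < r" and C: "0 \<le> C"
    and wb: "\<And>f. f \<in> Lp p ?M \<Longrightarrow>
       (\<integral>\<^sup>+x. ennreal \<bar>f x\<bar> \<partial>lebesgue_on ({a<..<b} \<inter> ball x0 r)) \<le> ennreal (C * Lp_norm p ?M f)"
    using noncritical_imp_weighted_bound[OF w p, of x0 0] x0 by auto
  define c where "c = max a (x0 - r)"
  define d where "d = min b (x0 + r)"
  \<comment> \<open>The neighbourhood is written as an interval for the fundamental theorem of calculus.\<close>
  have J: "{a<..<b} \<inter> ball x0 r = {c<..<d}" by (auto simp: c_def d_def dist_real_def)
  have cd: "c < d" using x0 r by (auto simp: c_def d_def)
  obtain U where U: "\<And>h. U h \<in> test_functions"
    and V: "\<And>j. j \<le> m \<Longrightarrow> (v(0 := u)) j \<in> Lp p ?M"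
    and N: "\<And>j. j \<le> m \<Longrightarrow> (\<lambda>h. Lp_norm p ?M (\<lambda>x. (deriv ^^ j) (U h) x - (v(0 := u)) j x)) \<longlonglongrightarrow> 0"
    using has_tangential_derivs_approx[OF D] by blast
  obtain U' where U': "\<And>h. U' h \<in> test_functions"
    and V': "\<And>j. j \<le> n \<Longrightarrow> (v'(0 := u)) j \<in> Lp p ?M"
    and N': "\<And>j. j \<le> n \<Longrightarrow> (\<lambda>h. Lp_norm p ?M (\<lambda>x. (deriv ^^ j) (U' h) x - (v'(0 := u)) j x)) \<longlonglongrightarrow> 0"
    using has_tangential_derivs_approx[OF D'] by blast
  define g where "g j x = (v(0 := u)) j x - (v'(0 := u)) j x" for j x
  define F where "F j h x = (deriv ^^ j) (U h) x - (deriv ^^ j) (U' h) x" for j h x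
  define \<alpha> where "\<alpha> j h = C * (Lp_norm p ?M (\<lambda>x. (deriv ^^ j) (U h) x - (v(0 := u)) j x)
      + Lp_norm p ?M (\<lambda>x. (deriv ^^ j) (U' h) x - (v'(0 := u)) j x))" for j h
  have \<alpha>0: "0 \<le> \<alpha> j h" for j h using C by (simp add: \<alpha>_def)
  have Lpm: "f \<in> borel_measurable (lebesgue_on {c<..<d})" if "f \<in> Lp p ?M" for f
    by (rule borel_measurable_lebesgue_on_subset[OF Lp_measurable[OF that]]) (auto simp: c_def d_def)
  have \<alpha>: "\<alpha> j \<longlonglongrightarrow> 0" if "j \<le> m" "j \<le> n" for j
  proof -
    have "\<alpha> j \<longlonglongrightarrow> C * (0 + 0)"
      unfolding \<alpha>_def by (intro tendsto_intros N N' that)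
    then show ?thesis by simp
  qed
  have Fg: "(\<integral>\<^sup>+x. ennreal \<bar>F j h x - g j x\<bar> \<partial>lebesgue_on {c<..<d}) \<le> ennreal (\<alpha> j h)"
    if j: "j \<le> m" "j \<le> n" for j h
  proof -
    define A where "A x = (deriv ^^ j) (U h) x - (v(0 := u)) j x" for x
    define B where "B x = (deriv ^^ j) (U' h) x - (v'(0 := u)) j x" for x
    have A: "A \<in> Lp p ?M"
      unfolding A_def[abs_def] by (intro Lp_diff[OF p] test_functions_Lp[OF w p U] V j)
    have B: "B \<in> Lp p ?M"
      unfolding B_def[abs_def] by (intro Lp_diff[OF p] test_functions_Lp[OF w p U'] V' j)
    have [measurable]: "A \<in> borel_measurable (lebesgue_on {c<..<d})" "B \<in> borel_measurable (lebesgue_on {c<..<d})"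
      by (intro Lpm A B)+
    have "(\<integral>\<^sup>+x. ennreal \<bar>F j h x - g j x\<bar> \<partial>lebesgue_on {c<..<d})
       \<le> (\<integral>\<^sup>+x. ennreal \<bar>A x\<bar> + ennreal \<bar>B x\<bar> \<partial>lebesgue_on {c<..<d})"
      by (intro nn_integral_mono) (simp add: F_def g_def A_def B_def flip: ennreal_plus)
    also have "\<dots> = (\<integral>\<^sup>+x. ennreal \<bar>A x\<bar> \<partial>lebesgue_on {c<..<d}) + (\<integral>\<^sup>+x. ennreal \<bar>B x\<bar> \<partial>lebesgue_on {c<..<d})"
      by (rule nn_integral_add) measurable
    also have "\<dots> \<le> ennreal (C * Lp_norm p ?M A) + ennreal (C * Lp_norm p ?M B)"
      using wb[OF A] wb[OF B] unfolding J by (rule add_mono)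
    also have "\<dots> = ennreal (\<alpha> j h)"
      using C by (simp add: \<alpha>_def A_def[abs_def] B_def[abs_def] distrib_left flip: ennreal_plus)
    finally show ?thesis .
  qed
  have "AE x in lebesgue_on {c<..<d}. g j x = 0"
    using j
  proof (induction j)
    case 0
    then show ?case by (simp add: g_def)
  next
    case (Suc j)
    then have j: "j \<le> m" "j \<le> n" and IH: "AE x in lebesgue_on {c<..<d}. g j x = 0" by auto
    show ?case
    proof (rule derivative_limit_zero[OF cd, where \<alpha> = "\<alpha> j" and \<beta> = "\<alpha> (Suc j)"])
      show "(F j h has_real_derivative F (Suc j) h t) (at t)" for h t
        unfolding F_def[abs_def]
        by (intro DERIV_diff test_functions_has_deriv U U')
      show "continuous_on UNIV (F (Suc j) h)" for h
        unfolding F_def[abs_def] by (intro continuous_on_diff test_functions_continuous U U')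
      show "g (Suc j) \<in> borel_measurable (lebesgue_on {c<..<d})"
        unfolding g_def[abs_def] by (intro borel_measurable_diff Lpm V V' Suc.prems)
      show "(\<integral>\<^sup>+x. ennreal \<bar>F (Suc j) h x - g (Suc j) x\<bar> \<partial>lebesgue_on {c<..<d}) \<le> ennreal (\<alpha> (Suc j) h)" for h
        by (intro Fg Suc.prems)
      show "(\<integral>\<^sup>+x. ennreal \<bar>F j h x\<bar> \<partial>lebesgue_on {c<..<d}) \<le> ennreal (\<alpha> j h)" for h
      proof -
        have "(\<integral>\<^sup>+x. ennreal \<bar>F j h x\<bar> \<partial>lebesgue_on {c<..<d}) = (\<integral>\<^sup>+x. ennreal \<bar>F j h x - g j x\<bar> \<partial>lebesgue_on {c<..<d})"
          by (intro nn_integral_cong_AE, use IH in eventually_elim) simp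
        with Fg[OF j] show ?thesis by simp
      qed
    qed (intro \<alpha>0 \<alpha> j Suc.prems)+
  qed
  then have "AE x in lebesgue_on ({a<..<b} \<inter> ball x0 r). (v(0 := u)) j x = (v'(0 := u)) j x"
    by (simp only: J g_def right_minus_eq)
  with r show ?thesis by blast
qed

text \<open>
  By the Lindeloef property countably many of the neighbourhoods suffice, so that \<open>P\<close> holds Lebesgue
  almost everywhere off the critical set, and the critical set is null for the weighted measure.
\<close>

lemma AE_noncritical_if_locally_AE:
  assumes w: "weight a b w" and nc: "ae_noncritical a b p w"
    and loc: "\<And>x0. x0 \<in> {a<..<b} \<Longrightarrow> x0 \<notin> critical_set a b p 0 w \<Longrightarrow>
       \<exists>r>0. AE x in lebesgue_on ({a<..<b} \<inter> ball x0 r). P x"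
  shows "AE x in weighted_measure a b w. P x"
proof -
  let ?M = "weighted_measure a b w" and ?I = "{a<..<b}"
  let ?N = "?I - critical_set a b p 0 w"
  obtain r where r: "\<And>x. x \<in> ?N \<Longrightarrow> 0 < r x"
    and rP: "\<And>x0. x0 \<in> ?N \<Longrightarrow> AE x in lebesgue_on (?I \<inter> ball x0 (r x0)). P x"
    using loc by (metis Diff_iff)
  obtain \<F> where \<F>: "\<F> \<subseteq> (\<lambda>x0. ball x0 (r x0)) ` ?N" "countable \<F>" "\<Union>\<F> = \<Union>((\<lambda>x0. ball x0 (r x0)) ` ?N)"
    using Lindelof[of "(\<lambda>x0. ball x0 (r x0)) ` ?N"] by auto
  have "AE x in lebesgue. \<forall>B\<in>\<F>. x \<in> ?I \<inter> B \<longrightarrow> P x"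
  proof (subst AE_ball_countable[OF \<F>(2)], intro ballI)
    fix B assume "B \<in> \<F>"
    with \<F>(1) obtain x0 where "x0 \<in> ?N" "B = ball x0 (r x0)" by blast
    with rP[of x0] show "AE x in lebesgue. x \<in> ?I \<inter> B \<longrightarrow> P x"
      by (simp add: AE_restrict_space_iff)
  qed
  then have "AE x in lebesgue. x \<in> ?I \<longrightarrow> x \<notin> critical_set a b p 0 w \<longrightarrow> P x"
  proof eventually_elim
    case (elim x)
    show ?case
    proof (intro impI)
      assume "x \<in> ?I" "x \<notin> critical_set a b p 0 w"
      then have "x \<in> \<Union>\<F>" unfolding \<F>(3) using r[of x] by (intro UN_I[of x]) auto
      with elim \<open>x \<in> ?I\<close> show "P x" by blast
    qed
  qed
  then have "AE x in lebesgue_on ?I. x \<notin> critical_set a b p 0 w \<longrightarrow> P x"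
    by (subst AE_restrict_space_iff) auto
  then have "AE x in ?M. x \<notin> critical_set a b p 0 w \<longrightarrow> P x"
    unfolding weighted_measure_def using weight_measurable[OF w]
    by (subst AE_density) (auto elim: eventually_mono)
  moreover have "AE x in ?M. x \<notin> critical_set a b p 0 w \<inter> ?I"
    using nc unfolding ae_noncritical_def by (rule AE_not_in)
  moreover have "AE x in ?M. x \<in> ?I"
    using AE_space by eventually_elim (simp add: weighted_measure_def space_restrict_space)
  ultimately show ?thesis by eventually_elim auto
qed

lemma tangential_derivs_unique:
  assumes w: "weight a b w" and p: "1 \<le> p" and nc: "ae_noncritical a b p w"
    and D: "has_tangential_derivs a b p w m u v" "has_tangential_derivs a b p w n u v'"
    and j: "1 \<le> j" "j \<le> m" "j \<le> n"
  shows "AE x in weighted_measure a b w. v j x = v' j x"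
  using tangential_derivs_agree_locally[OF w p _ _ D j(2,3)] j(1)
  by (intro AE_noncritical_if_locally_AE[OF w nc]) simp

lemma Lp_norm_cong_AE:
  assumes "AE x in M. f x = g x" "f \<in> Lp p M" "g \<in> Lp p M"
  shows "Lp_norm p M f = Lp_norm p M g"
proof -
  have "(\<integral>x. \<bar>f x\<bar> powr p \<partial>M) = (\<integral>x. \<bar>g x\<bar> powr p \<partial>M)"
    using assms by (intro integral_cong_AE) (auto simp: Lp_def)
  then show ?thesis by (simp add: Lp_norm_def)
qed

text \<open>
  The tangential derivative of order \<open>j\<close> is chosen from the witnesses of order \<open>j\<close>, while \<open>v\<close> is a witness
  of order \<open>k\<close>. Uniqueness reconciles the two choices up to a null set.
\<close>

lemma Lp_norm_tangential_deriv:
  assumes w: "weight a b w" and p: "1 \<le> p" and nc: "ae_noncritical a b p w"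
    and D: "has_tangential_derivs a b p w k u v" and j: "j \<le> k"
  shows "Lp_norm p (weighted_measure a b w) (tangential_deriv a b p w j u)
       = Lp_norm p (weighted_measure a b w) ((v(0 := u)) j)"
proof (cases "j = 0")
  case True
  then show ?thesis by (simp add: tangential_deriv_def)
next
  case False
  have "has_tangential_derivs a b p w j u v"
    using D j unfolding has_tangential_derivs_def Let_def by (meson atLeastAtMost_iff order_trans)
  then have "\<exists>d v'. has_tangential_derivs a b p w j u v' \<and> v' j = d" by blast
  from someI_ex[OF this] obtain v' where v': "has_tangential_derivs a b p w j u v'"
    "v' j = tangential_deriv a b p w j u"
    using False by (auto simp: tangential_deriv_def)
  have "Lp_norm p (weighted_measure a b w) (v' j) = Lp_norm p (weighted_measure a b w) (v j)"
  proof (rule Lp_norm_cong_AE)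
    show "AE x in weighted_measure a b w. v' j x = v j x"
      using False j by (intro tangential_derivs_unique[OF w p nc v'(1) D]) auto
    show "v' j \<in> Lp p (weighted_measure a b w)" "v j \<in> Lp p (weighted_measure a b w)"
      using v'(1) D False j by (auto simp: has_tangential_derivs_def Let_def)
  qed
  then show ?thesis using v'(2) False by simp
qed

lemma Lp_norm_tangential_deriv_le_sobolev_norm:
  assumes "1 \<le> p" "j \<le> k"
  shows "Lp_norm p (weighted_measure a b w) (tangential_deriv a b p w j u) \<le> sobolev_norm a b p w k u"
proof -
  let ?n = "\<lambda>j. Lp_norm p (weighted_measure a b w) (tangential_deriv a b p w j u)"
  have "?n j = (?n j powr p) powr (1 / p)"
    using assms(1) by (simp add: powr_powr)
  also have "\<dots> \<le> (\<Sum>j=0..k. ?n j powr p) powr (1 / p)"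
    using assms by (intro powr_mono2 member_le_sum) auto
  finally show ?thesis by (simp add: sobolev_norm_def)
qed

section \<open>The embedding\<close>

lemma sobolev_Lp: "u \<in> sobolev a b p w k \<Longrightarrow> u \<in> Lp p (weighted_measure a b w)"
  by (auto simp: sobolev_def split: if_splits)

lemma sobolev_norm_nonneg: "0 \<le> sobolev_norm a b p w k u"
  by (simp add: sobolev_norm_def)

lemma sobolev_local_bound:
  assumes w: "weight a b w" and p: "1 \<le> p" and ab: "a < b" and nc: "ae_noncritical a b p w"
    and x0: "x0 \<in> {a..b}" "x0 \<notin> critical_set a b p (real k) w"
  shows "\<exists>r>0. \<exists>K\<ge>0. \<forall>u\<in>sobolev a b p w k.
     (\<integral>\<^sup>+x. ennreal \<bar>u x\<bar> \<partial>lebesgue_on ({a<..<b} \<inter> ball x0 r)) \<le> ennreal (K * sobolev_norm a b p w k u)"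
proof (cases "k = 0")
  case True
  obtain r C where "0 < r" "0 \<le> C"
    and wb: "\<And>f. f \<in> Lp p (weighted_measure a b w) \<Longrightarrow>
       (\<integral>\<^sup>+x. ennreal (\<bar>x - x0\<bar> ^ k * \<bar>f x\<bar>) \<partial>lebesgue_on ({a<..<b} \<inter> ball x0 r))
         \<le> ennreal (C * Lp_norm p (weighted_measure a b w) f)"
    using noncritical_imp_weighted_bound[OF w p x0] by blast
  moreover have "sobolev_norm a b p w k u = Lp_norm p (weighted_measure a b w) u" for u
    using True p by (simp add: sobolev_norm_def tangential_deriv_def powr_powr)
  moreover have "(\<integral>\<^sup>+x. ennreal \<bar>u x\<bar> \<partial>lebesgue_on ({a<..<b} \<inter> ball x0 r))
      \<le> ennreal (C * Lp_norm p (weighted_measure a b w) u)" if "u \<in> sobolev a b p w k" for u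
    using wb[OF sobolev_Lp[OF that]] True by simp
  ultimately show ?thesis by metis
next
  case False
  let ?M = "weighted_measure a b w"
  obtain r K where "0 < r" and K: "0 \<le> K"
    and bound: "\<And>u v. has_tangential_derivs a b p w k u v \<Longrightarrow>
       (\<integral>\<^sup>+x. ennreal \<bar>u x\<bar> \<partial>lebesgue_on ({a<..<b} \<inter> ball x0 r))
         \<le> ennreal (K * (\<Sum>j\<le>k. Lp_norm p ?M ((v(0 := u)) j)))"
    using noncritical_imp_tangential_bound[OF w p ab x0] by blast
  have "(\<integral>\<^sup>+x. ennreal \<bar>u x\<bar> \<partial>lebesgue_on ({a<..<b} \<inter> ball x0 r))
      \<le> ennreal ((K * real (Suc k)) * sobolev_norm a b p w k u)"
    if u: "u \<in> sobolev a b p w k" for u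
  proof -
    obtain v where v: "has_tangential_derivs a b p w k u v"
      using u False by (auto simp: sobolev_def)
    have "(\<Sum>j\<le>k. Lp_norm p ?M ((v(0 := u)) j)) = (\<Sum>j\<le>k. Lp_norm p ?M (tangential_deriv a b p w j u))"
      by (intro sum.cong refl Lp_norm_tangential_deriv[OF w p nc v, symmetric]) simp
    also have "\<dots> \<le> (\<Sum>j\<le>k. sobolev_norm a b p w k u)"
      by (intro sum_mono Lp_norm_tangential_deriv_le_sobolev_norm p) simp
    finally have "K * (\<Sum>j\<le>k. Lp_norm p ?M ((v(0 := u)) j)) \<le> K * (real (Suc k) * sobolev_norm a b p w k u)"
      using K by (intro mult_left_mono) simp_all
    from order_trans[OF bound[OF v] ennreal_leI[OF this]] show ?thesis
      by (simp only: mult.assoc)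
  qed
  moreover have "0 \<le> K * real (Suc k)" using K by simp
  ultimately show ?thesis using \<open>0 < r\<close> by blast
qed

text \<open>
  Values at the endpoints of the interval are arbitrary. They affect neither the integral nor,
  since finite sets are Lebesgue sets, the measurability on \<open>V\<close>.
\<close>

lemma embeds_L1_if_nn_integral_bound:
  assumes ab: "a < b" and V: "V \<in> sets lebesgue" "V \<subseteq> {a..b}" and K: "0 \<le> K"
    and bound: "\<And>u. u \<in> sobolev a b p w k \<Longrightarrow>
      (\<integral>\<^sup>+x. ennreal \<bar>u x\<bar> \<partial>lebesgue_on ({a<..<b} \<inter> V)) \<le> ennreal (K * sobolev_norm a b p w k u)"
  shows "sobolev_embeds_L1 a b p w k V"
  unfolding sobolev_embeds_L1_def
proof (intro exI[of _ K] ballI conjI)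
  fix u assume u: "u \<in> sobolev a b p w k"
  let ?I = "{a<..<b}"
  have Iu: "(\<lambda>x. indicator ?I x * u x) \<in> borel_measurable lebesgue"
    using Lp_measurable[OF sobolev_Lp[OF u]] by (simp add: borel_measurable_restrict_space_iff)
  have eq1: "(\<lambda>x. indicator V x * u x)
      = (\<lambda>x. indicator V x * (indicator ?I x * u x) + indicator (V \<inter> {a}) x * u a + indicator (V \<inter> {b}) x * u b)"
  proof
    fix x
    show "indicator V x * u x
        = indicator V x * (indicator ?I x * u x) + indicator (V \<inter> {a}) x * u a + indicator (V \<inter> {b}) x * u b"
      using V(2) ab by (cases "x \<in> {a, b}") (auto split: split_indicator)
  qed
  have [measurable]: "(\<lambda>x. indicator V x * u x) \<in> borel_measurable lebesgue"
    unfolding eq1 using V(1)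
    by (intro borel_measurable_add borel_measurable_times[OF borel_measurable_indicator Iu]
        borel_measurable_times[OF borel_measurable_indicator borel_measurable_const]) auto
  have IV: "?I \<inter> V \<in> sets lebesgue" using V(1) by (intro sets.Int) auto
  have eq: "(\<integral>\<^sup>+x. ennreal (norm (indicator V x * u x)) \<partial>lebesgue)
      = (\<integral>\<^sup>+x. ennreal \<bar>u x\<bar> \<partial>lebesgue_on (?I \<inter> V))"
  proof -
    have "AE x in lebesgue. x \<noteq> a \<and> x \<noteq> b"
      using AE_completion[OF AE_lborel_singleton[of a]] AE_completion[OF AE_lborel_singleton[of b]]
      by eventually_elim simp
    then have "(\<integral>\<^sup>+x. ennreal (norm (indicator V x * u x)) \<partial>lebesgue)
        = (\<integral>\<^sup>+x. ennreal \<bar>u x\<bar> * indicator (?I \<inter> V) x \<partial>lebesgue)"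
      by (intro nn_integral_cong_AE, elim eventually_mono) (use V(2) in \<open>auto split: split_indicator\<close>)
    then show ?thesis using IV by (simp add: nn_integral_restrict_space)
  qed
  have le: "(\<integral>\<^sup>+x. ennreal (norm (indicator V x * u x)) \<partial>lebesgue) \<le> ennreal (K * sobolev_norm a b p w k u)"
    unfolding eq by (rule bound[OF u])
  then show "set_integrable lebesgue V u"
    unfolding set_integrable_def by (intro integrableI_bounded) (auto simp: le_less_trans)
  have "(LINT x:V|lebesgue. \<bar>u x\<bar>) = (\<integral>x. norm (indicator V x * u x) \<partial>lebesgue)"
    by (simp add: set_lebesgue_integral_def abs_mult)
  also have "\<dots> \<le> K * sobolev_norm a b p w k u"
    using le K sobolev_norm_nonneg[of a b p w k u]
    by (subst integral_eq_nn_integral) (auto intro!: enn2real_leI)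
  finally show "(LINT x:V|lebesgue. \<bar>u x\<bar>) \<le> K * sobolev_norm a b p w k u" .
qed

theorem theorem3p6:
  fixes a b p x0 :: real and w :: "real \<Rightarrow> real" and k :: nat
  assumes "a < b"
    and "1 \<le> p"
    and "weight a b w"
    and "ae_noncritical a b p w"
    and "x0 \<in> {a..b}"
  shows "(x0 \<notin> critical_set a b p (real k) w \<longrightarrow>
           (\<exists>V. openin (top_of_set {a..b}) V \<and> x0 \<in> V \<and> sobolev_embeds_L1 a b p w k V))
       \<and> (critical_set a b p (real k) w = {} \<longrightarrow> sobolev_embeds_L1 a b p w k {a..b})"
proof (intro conjI impI)
  note loc = sobolev_local_bound[OF assms(3,2,1,4)]
  assume "x0 \<notin> critical_set a b p (real k) w"
  from loc[OF assms(5) this] obtain r K where "0 < r" "0 \<le> K"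
    and bound: "\<And>u. u \<in> sobolev a b p w k \<Longrightarrow>
      (\<integral>\<^sup>+x. ennreal \<bar>u x\<bar> \<partial>lebesgue_on ({a<..<b} \<inter> ball x0 r)) \<le> ennreal (K * sobolev_norm a b p w k u)"
    by blast
  let ?V = "{a..b} \<inter> ball x0 r"
  have "{a<..<b} \<inter> ?V = {a<..<b} \<inter> ball x0 r" by auto
  then have "sobolev_embeds_L1 a b p w k ?V"
    by (intro embeds_L1_if_nn_integral_bound[OF assms(1) _ _ \<open>0 \<le> K\<close>]) (simp_all add: bound)
  moreover have "openin (top_of_set {a..b}) ?V" by (simp add: openin_open_Int)
  moreover have "x0 \<in> ?V" using assms(5) \<open>0 < r\<close> by simp
  ultimately show "\<exists>V. openin (top_of_set {a..b}) V \<and> x0 \<in> V \<and> sobolev_embeds_L1 a b p w k V"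
    by blast
next
  assume none: "critical_set a b p (real k) w = {}"
  let ?I = "{a<..<b}"
  have "\<forall>x\<in>{a..b}. \<exists>r K. 0 < r \<and> 0 \<le> K \<and> (\<forall>u\<in>sobolev a b p w k.
      (\<integral>\<^sup>+y. ennreal \<bar>u y\<bar> \<partial>lebesgue_on (?I \<inter> ball x r)) \<le> ennreal (K * sobolev_norm a b p w k u))"
    using sobolev_local_bound[OF assms(3,2,1,4)] none by (metis empty_iff)
  then obtain r K where r: "\<And>x. x \<in> {a..b} \<Longrightarrow> 0 < r x" and K: "\<And>x. x \<in> {a..b} \<Longrightarrow> 0 \<le> K x"
    and bound: "\<And>x u. x \<in> {a..b} \<Longrightarrow> u \<in> sobolev a b p w k \<Longrightarrow>
      (\<integral>\<^sup>+y. ennreal \<bar>u y\<bar> \<partial>lebesgue_on (?I \<inter> ball x (r x))) \<le> ennreal (K x * sobolev_norm a b p w k u)"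
    by metis
  have "{a..b} \<subseteq> (\<Union>x\<in>{a..b}. ball x (r x))" using r by auto
  then obtain D where D: "D \<subseteq> {a..b}" "finite D" "{a..b} \<subseteq> (\<Union>x\<in>D. ball x (r x))"
    using compactE_image[OF compact_Icc, of "{a..b}" "\<lambda>x. ball x (r x)"] by (metis open_ball)
  show "sobolev_embeds_L1 a b p w k {a..b}"
  proof (rule embeds_L1_if_nn_integral_bound[OF assms(1)])
    show "0 \<le> (\<Sum>x\<in>D. K x)" using K D(1) by (intro sum_nonneg) auto
    fix u assume u: "u \<in> sobolev a b p w k"
    have um: "u \<in> borel_measurable (lebesgue_on ?I)" by (rule Lp_measurable[OF sobolev_Lp[OF u]])
    have meas: "(\<lambda>y. ennreal \<bar>u y\<bar> * indicator (?I \<inter> ball x (r x)) y) \<in> borel_measurable lebesgue" for x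
    proof -
      have [measurable]: "u \<in> borel_measurable (lebesgue_on (?I \<inter> ball x (r x)))"
        by (rule borel_measurable_lebesgue_on_subset[OF um]) auto
      have "(\<lambda>y. ennreal \<bar>u y\<bar>) \<in> borel_measurable (lebesgue_on (?I \<inter> ball x (r x)))" by measurable
      then show ?thesis by (subst (asm) borel_measurable_restrict_space_iff_ennreal) auto
    qed
    have "(\<integral>\<^sup>+y. ennreal \<bar>u y\<bar> \<partial>lebesgue_on (?I \<inter> {a..b}))
        \<le> (\<integral>\<^sup>+y. (\<Sum>x\<in>D. ennreal \<bar>u y\<bar> * indicator (?I \<inter> ball x (r x)) y) \<partial>lebesgue)"
    proof -
      have "ennreal \<bar>u y\<bar> * indicator (?I \<inter> {a..b}) y \<le> (\<Sum>x\<in>D. ennreal \<bar>u y\<bar> * indicator (?I \<inter> ball x (r x)) y)" for y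
      proof (cases "y \<in> ?I")
        case True
        then have "y \<in> {a..b}" by simp
        with D(3) obtain x where "x \<in> D" "y \<in> ball x (r x)" by blast
        then have "ennreal \<bar>u y\<bar> * indicator (?I \<inter> {a..b}) y = ennreal \<bar>u y\<bar> * indicator (?I \<inter> ball x (r x)) y"
          using True by simp
        also have "\<dots> \<le> (\<Sum>x\<in>D. ennreal \<bar>u y\<bar> * indicator (?I \<inter> ball x (r x)) y)"
          using \<open>x \<in> D\<close> D(2) by (intro member_le_sum) auto
        finally show ?thesis .
      qed (auto simp: indicator_def)
      then show ?thesis by (auto simp: nn_integral_restrict_space intro!: nn_integral_mono)
    qed
    also have "\<dots> = (\<Sum>x\<in>D. \<integral>\<^sup>+y. ennreal \<bar>u y\<bar> * indicator (?I \<inter> ball x (r x)) y \<partial>lebesgue)"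
      by (intro nn_integral_sum meas)
    also have "\<dots> \<le> (\<Sum>x\<in>D. ennreal (K x * sobolev_norm a b p w k u))"
      using bound[OF _ u] D(1) by (intro sum_mono) (auto simp: nn_integral_restrict_space)
    also have "\<dots> = ennreal ((\<Sum>x\<in>D. K x) * sobolev_norm a b p w k u)"
      using K D(1) sobolev_norm_nonneg[of a b p w k u]
      by (subst sum_ennreal) (auto simp: sum_distrib_right)
    finally show "(\<integral>\<^sup>+y. ennreal \<bar>u y\<bar> \<partial>lebesgue_on (?I \<inter> {a..b}))
        \<le> ennreal ((\<Sum>x\<in>D. K x) * sobolev_norm a b p w k u)" .
  qed simp_all
qed

end
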